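(* Consider the three-dimensional compound autoregressive model for count variables $(X,Y,Z)$: $$X\mid Y,Z\;\overset{d}{=}\;\sum_{i=1}^YW_{1i}+\sum_{i=1}^ZW_{2i}+\epsilon_1,$$ $$Y\mid X,Z\;\overset{d}{=}\;\sum_{i=1}^XW_{3i}+\sum_{i=1}^ZW_{4i}+\epsilon_2,$$ $$Z\mid X,Y\;\overset{d}{=}\;\sum_{i=1}^XW_{5i}+\sum_{i=1}^YW_{6i}+\epsilon_3.$$ The only non-degenerate solution to this model is the Poisson-gamma conjugacy model: $U$ follows a gamma distribution and, given $U$, the variables $X,Y,Z$ are conditionally independent and Poisson distributed with parameters $\lambda_1U,\lambda_2U,\lambda_3U$, respectively. Here non-degenerate means that $W_{1i},\dots,W_{6i}$ should not be constant variables such as zero.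
   Context: Count variables are $\mathbb{N}_0$-valued, $\mathbb{N}_0=\{0,1,2,\dots\}$, and $\overset{d}{=}$ denotes equality in distribution. A solution is a joint distribution of $(X,Y,Z)$ that leads to the postulated conditional distributions. In the model, $(W_{1i})$ and $(W_{2i})$ are i.i.d. sequences, mutually independent and independent of $Y,Z$ and $\epsilon_1$; $(W_{3i})$ and $(W_{4i})$ are i.i.d. sequences, mutually independent and independent of $X,Z$ and $\epsilon_2$; $(W_{5i})$ and $(W_{6i})$ are i.i.d. sequences, mutually independent and independent of $X,Y$ and $\epsilon_3$; $\epsilon_1$ is independent of $Y,Z$, $\epsilon_2$ is independent of $X,Z$, and $\epsilon_3$ is independent of $X,Y$. Equivalently, $\mathbb{E}[u^X\mid Y,Z]=(\mathbb{E}[u^{W_{11}}])^Y(\mathbb{E}[u^{W_{21}}])^Z\,\mathbb{E}[u^{\epsilon_1}]$, $\mathbb{E}[v^Y\mid X,Z]=(\mathbb{E}[v^{W_{31}}])^X(\mathbb{E}[v^{W_{41}}])^Z\,\mathbb{E}[v^{\epsilon_2}]$ and $\mathbb{E}[t^Z\mid X,Y]=(\mathbb{E}[t^{W_{51}}])^X(\mathbb{E}[t^{W_{61}}])^Y\,\mathbb{E}[t^{\epsilon_3}]$.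
   Formalization: Each of X, Y, Z is additionally required to take every value 0, 1, 2, … with positive probability; otherwise e.g. (X+1, Y, Z) or (2X, Y, Z) with (X, Y, Z) Poisson-gamma (shape at least 1 for the shift) also solves the model with non-constant W's. *)

theory Defs
  imports "HOL-Probability.Probability"
begin

text \<open>
  The triple of count variables is represented by its joint distribution, a pmf on
  \<open>nat \<times> nat \<times> nat\<close>. The coordinates play the roles of X, Y, Z.
\<close>

definition X_of :: "nat \<times> nat \<times> nat \<Rightarrow> nat" where
  "X_of = (\<lambda>(x, y, z). x)"

definition Y_of :: "nat \<times> nat \<times> nat \<Rightarrow> nat" where
  "Y_of = (\<lambda>(x, y, z). y)"

definition Z_of :: "nat \<times> nat \<times> nat \<Rightarrow> nat" where
  "Z_of = (\<lambda>(x, y, z). z)"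

text \<open>
  Each variable has all of \<open>{0, 1, 2, \<dots>}\<close> as its range. Without this, the uniqueness part of
  the characterization fails: the point mass at (0, 0, 0), shifted triples such as
  (X + 1, Y, Z), and scaled triples such as (2 X, Y, Z) can satisfy the model with
  non-constant summands.
\<close>

definition count_variables :: "(nat \<times> nat \<times> nat) pmf \<Rightarrow> bool" where
  "count_variables p \<longleftrightarrow>
     set_pmf (map_pmf X_of p) = UNIV \<and>
     set_pmf (map_pmf Y_of p) = UNIV \<and>
     set_pmf (map_pmf Z_of p) = UNIV"

text \<open>
  Law of \<open>(\<Sum>i=1..m. W i) + (\<Sum>i=1..n. V i) + eps\<close>, where all the summands are independent,
  the \<open>W i\<close> have law \<open>W\<close> and the \<open>V i\<close> have law \<open>V\<close>.
\<close>

definition compound_pmf :: "nat pmf \<Rightarrow> nat pmf \<Rightarrow> nat pmf \<Rightarrow> nat \<Rightarrow> nat \<Rightarrow> nat pmf" where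
  "compound_pmf W V eps m n =
     map_pmf (\<lambda>(w, v, e). (\<Sum>i\<in>{1..m}. w i) + (\<Sum>i\<in>{1..n}. v i) + e)
       (pair_pmf (Pi_pmf {1..m} 0 (\<lambda>_. W)) (pair_pmf (Pi_pmf {1..n} 0 (\<lambda>_. V)) eps))"

text \<open>
  The conditional law of \<open>A\<close> given \<open>(B, C) = (b, c)\<close> is the compound law with \<open>b\<close> and \<open>c\<close>
  summands. As usual for conditional laws, this is required only for the values \<open>(b, c)\<close>
  attained with positive probability (elsewhere \<open>cond_pmf\<close> is unspecified).
\<close>

definition conditionally_compound ::
  "(nat \<times> nat \<times> nat) pmf \<Rightarrow> (nat \<times> nat \<times> nat \<Rightarrow> nat) \<Rightarrow>
   (nat \<times> nat \<times> nat \<Rightarrow> nat) \<Rightarrow> (nat \<times> nat \<times> nat \<Rightarrow> nat) \<Rightarrow>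
   nat pmf \<Rightarrow> nat pmf \<Rightarrow> nat pmf \<Rightarrow> bool" where
  "conditionally_compound p A B C W V eps \<longleftrightarrow>
     (\<forall>(b, c) \<in> set_pmf (map_pmf (\<lambda>s. (B s, C s)) p).
        map_pmf A (cond_pmf p {s. B s = b \<and> C s = c}) = compound_pmf W V eps b c)"

definition solves_model ::
  "(nat \<times> nat \<times> nat) pmf \<Rightarrow>
   nat pmf \<Rightarrow> nat pmf \<Rightarrow> nat pmf \<Rightarrow> nat pmf \<Rightarrow> nat pmf \<Rightarrow> nat pmf \<Rightarrow>
   nat pmf \<Rightarrow> nat pmf \<Rightarrow> nat pmf \<Rightarrow> bool" where
  "solves_model p W1 W2 W3 W4 W5 W6 eps1 eps2 eps3 \<longleftrightarrow>
     conditionally_compound p X_of Y_of Z_of W1 W2 eps1 \<and>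
     conditionally_compound p Y_of X_of Z_of W3 W4 eps2 \<and>
     conditionally_compound p Z_of X_of Y_of W5 W6 eps3"

definition nonconstant :: "nat pmf \<Rightarrow> bool" where
  "nonconstant W \<longleftrightarrow> (\<nexists>c. W = return_pmf c)"

text \<open>
  Gamma distribution with shape \<open>a\<close> and rate \<open>b\<close>, on the positive half-line. The restriction
  of the space keeps the Poisson rates below positive, since \<open>poisson_pmf\<close> is unspecified at
  negative rates.
\<close>

definition gamma_distribution :: "real \<Rightarrow> real \<Rightarrow> real measure" where
  "gamma_distribution a b =
     density (restrict_space lborel {0<..})
       (\<lambda>u. ennreal (b powr a / Gamma a * u powr (a - 1) * exp (- b * u)))"

definition poisson_gamma :: "real \<Rightarrow> real \<Rightarrow> real \<Rightarrow> real \<Rightarrow> real \<Rightarrow> (nat \<times> nat \<times> nat) measure" where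
  "poisson_gamma a b l1 l2 l3 =
     gamma_distribution a b \<bind>
       (\<lambda>u. measure_pmf (pair_pmf (poisson_pmf (l1 * u))
              (pair_pmf (poisson_pmf (l2 * u)) (poisson_pmf (l3 * u)))))"

end

theory Submission
  imports Defs
begin

text \<open>
  Writing r x y z for the probability of (x, y, z), each conditional law says that, as a function of
  one coordinate, r is proportional to the coefficients of a product f^y g^z e of probability
  generating functions. Comparing supports shows first that all constant terms are positive and then
  that r is positive everywhere, so one may normalize the constant terms to 1:
  r x y z = r 0 y z * [u^x] (a1(u)^y a2(u)^z e1(u)), and similarly for the other coordinates.

  The coefficient of u in this identity is affine in (y, z). Computing r 1 y 1 in two ways, and likewise
  for the other pairs of coordinates, forces the three affine functions to have a common
  relative slope \<open>\<kappa>\<close>. Computing r x 1 0, r x 0 1 and r x 1 1 in two ways then yields, with D = u d/du,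
  the equations a1 = a2 = A, A e1 = e1 + \<open>\<kappa>\<close> D e1 and D A = A^2 - A, whence A = 1 / (1 - \<open>\<rho>\<close>u) and
  e1 = (1 - \<open>\<rho>\<close>u) powr (-1/\<open>\<kappa>\<close>). So r is a negative multinomial law, which is the Poisson-gamma mixture.
\<close>

section \<open>Generating functions of count distributions\<close>

definition pmf_fps :: "nat pmf \<Rightarrow> real fps" where
  "pmf_fps M = Abs_fps (pmf M)"

lemma pmf_fps_nth [simp]: "fps_nth (pmf_fps M) n = pmf M n"
  by (simp add: pmf_fps_def)

lemma pmf_fps_return_0: "pmf_fps (return_pmf 0) = 1"
  by (rule fps_ext) (simp add: fps_one_nth)

lemma pmf_fps_add:
  "pmf_fps (map_pmf (\<lambda>(a, b). a + b) (pair_pmf M N)) = pmf_fps M * pmf_fps N"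
proof (rule fps_ext)
  fix n :: nat
  let ?S = "(\<lambda>i. (i, n - i)) ` {0..n}"
  have "(\<lambda>(a, b). a + b) -` {n} = ?S"
    by force
  then have "pmf (map_pmf (\<lambda>(a, b). a + b) (pair_pmf M N)) n = measure (pair_pmf M N) ?S"
    by (simp add: pmf_map)
  also have "\<dots> = (\<Sum>s\<in>?S. pmf (pair_pmf M N) s)"
    by (rule measure_measure_pmf_finite) simp
  also have "\<dots> = (\<Sum>i=0..n. pmf M i * pmf N (n - i))"
    by (subst sum.reindex) (auto simp: inj_on_def pmf_pair)
  finally show "fps_nth (pmf_fps (map_pmf (\<lambda>(a, b). a + b) (pair_pmf M N))) n
      = fps_nth (pmf_fps M * pmf_fps N) n"
    by (simp add: fps_mult_nth)
qed

lemma pmf_fps_sum_Pi_pmf: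
  assumes "finite A"
  shows "pmf_fps (map_pmf (\<lambda>w. \<Sum>i\<in>A. w i) (Pi_pmf A d (\<lambda>_. W))) = pmf_fps W ^ card A"
  using assms
proof (induction A rule: finite_induct)
  case empty
  then show ?case by (simp add: pmf_fps_return_0)
next
  case (insert a A)
  have "map_pmf (\<lambda>w. \<Sum>i\<in>insert a A. w i) (Pi_pmf (insert a A) d (\<lambda>_. W))
      = map_pmf (\<lambda>(y, f). y + (\<Sum>i\<in>A. f i)) (pair_pmf W (Pi_pmf A d (\<lambda>_. W)))"
  proof -
    have "(\<Sum>i\<in>A. (f(a := y)) i) = (\<Sum>i\<in>A. f i)" for f :: "'a \<Rightarrow> nat" and y
      using insert by (intro sum.cong) auto
    then show ?thesis
      using insert by (simp add: Pi_pmf_insert map_pmf_comp case_prod_beta')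
  qed
  also have "\<dots> = map_pmf (\<lambda>(a, b). a + b)
      (pair_pmf W (map_pmf (\<lambda>w. \<Sum>i\<in>A. w i) (Pi_pmf A d (\<lambda>_. W))))"
    by (simp add: pair_map_pmf2 map_pmf_comp case_prod_beta')
  finally show ?case
    using insert by (simp add: pmf_fps_add)
qed

lemma pmf_fps_compound:
  "pmf_fps (compound_pmf W V eps m n) = pmf_fps W ^ m * pmf_fps V ^ n * pmf_fps eps"
proof -
  let ?P = "\<lambda>W k. Pi_pmf {1..k::nat} (0::nat) (\<lambda>_. W)"
  let ?s = "\<lambda>k w. \<Sum>i\<in>{1..k::nat}. w i :: nat"
  have "compound_pmf W V eps m n = map_pmf (\<lambda>(a, b). a + b) (pair_pmf (map_pmf (?s m) (?P W m))
      (map_pmf (\<lambda>(a, b). a + b) (pair_pmf (map_pmf (?s n) (?P V n)) eps)))"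
    unfolding compound_pmf_def
    by (simp add: pair_map_pmf1 pair_map_pmf2 map_pmf_comp case_prod_beta' add.assoc)
  then show ?thesis
    by (simp add: pmf_fps_add pmf_fps_sum_Pi_pmf mult.assoc)
qed

lemma pmf_fps_nonzero:
  obtains i where "0 < fps_nth (pmf_fps M) i"
proof -
  obtain i where "i \<in> set_pmf M"
    by (metis ex_in_conv set_pmf_not_empty)
  then show ?thesis
    using that by (simp add: pmf_positive_iff)
qed

lemma pmf_fps_pos_coeff:
  assumes "nonconstant W"
  obtains i where "0 < i" "0 < fps_nth (pmf_fps W) i"
proof -
  have "\<not> set_pmf W \<subseteq> {0}"
    using assms by (auto simp: nonconstant_def set_pmf_subset_singleton)
  then show ?thesis
    using that by (auto simp: pmf_positive_iff)
qed

text \<open>Summing over all values turns the hypothesis into \<open>1 = k\<close>, so a normalizing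
  constant never has to be computed.\<close>

lemma pmf_eqI_proportional:
  assumes "\<And>x. pmf M x = k * pmf N x"
  shows "M = N"
proof -
  have "1 = infsetsum (pmf M) UNIV"
    by (simp add: infsetsum_pmf_eq_1)
  also have "\<dots> = k * infsetsum (pmf N) UNIV"
    by (subst infsetsum_cmult_right[symmetric]) (auto simp: assms[abs_def] pmf_abs_summable)
  finally show ?thesis
    by (intro pmf_eqI) (simp add: infsetsum_pmf_eq_1 assms)
qed

section \<open>Conditional laws as proportional rows\<close>

text \<open>Zero rows are exempt because they correspond to pairs of values of probability zero.\<close>

definition proportional_rows ::
  "(nat \<Rightarrow> nat \<Rightarrow> nat \<Rightarrow> real) \<Rightarrow> real fps \<Rightarrow> real fps \<Rightarrow> real fps \<Rightarrow> bool" where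
  "proportional_rows r f g e \<longleftrightarrow>
     (\<forall>y z. (\<exists>x. 0 < r x y z) \<longrightarrow> (\<exists>k. \<forall>x. r x y z = k * fps_nth (f ^ y * g ^ z * e) x))"

text \<open>The map \<open>h\<close> inverts the coordinate triple \<open>(A, B, C)\<close>, so the
  fibre over \<open>(b, c)\<close> meets \<open>A = a\<close> in the single point
  \<open>h a b c\<close>. Keeping \<open>h\<close> abstract lets one argument serve all three orders
  of the coordinates.\<close>

lemma pmf_map_cond_pmf_coordinates:
  assumes h: "\<And>s. h (A s) (B s) (C s) = s"
    and ABC: "\<And>a b c. A (h a b c) = a" "\<And>a b c. B (h a b c) = b" "\<And>a b c. C (h a b c) = c"
    and pos: "0 < pmf p (h a' b c)"
  shows "pmf (map_pmf A (cond_pmf p {s. B s = b \<and> C s = c})) a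
      = pmf p (h a b c) / measure p {s. B s = b \<and> C s = c}"
    and "0 < measure p {s. B s = b \<and> C s = c}"
proof -
  let ?S = "{s. B s = b \<and> C s = c}"
  have mem: "h a' b c \<in> set_pmf p" "h a' b c \<in> ?S"
    using pos by (simp_all add: pmf_positive_iff ABC)
  then have ne: "set_pmf p \<inter> ?S \<noteq> {}"
    by blast
  show "0 < measure p ?S"
    using mem by (intro measure_pmf_posI)
  have "pmf (map_pmf A (cond_pmf p ?S)) a = measure (cond_pmf p ?S) (A -` {a})"
    by (simp add: pmf_map)
  also have "\<dots> = measure (cond_pmf p ?S) (A -` {a} \<inter> ?S)"
    by (intro measure_prob_cong_0) (auto simp: pmf_cond[OF ne])
  also have "A -` {a} \<inter> ?S = {h a b c}"
    using h ABC by auto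
  also have "measure (cond_pmf p ?S) {h a b c} = pmf p (h a b c) / measure p ?S"
    by (simp add: measure_pmf_single pmf_cond[OF ne] ABC)
  finally show "pmf (map_pmf A (cond_pmf p ?S)) a = pmf p (h a b c) / measure p ?S" .
qed

text \<open>Conditioning divides a row by the mass of its fibre, which supplies the factor
  \<open>k\<close>. Conversely any \<open>k\<close> will do, because two proportional probability
  laws coincide. This removes conditional laws from the rest of the argument.\<close>

lemma conditionally_compound_iff_proportional_rows:
  assumes h: "\<And>s. h (A s) (B s) (C s) = s"
    and ABC: "\<And>a b c. A (h a b c) = a" "\<And>a b c. B (h a b c) = b" "\<And>a b c. C (h a b c) = c"
  shows "conditionally_compound p A B C W V eps \<longleftrightarrow>
    proportional_rows (\<lambda>a b c. pmf p (h a b c)) (pmf_fps W) (pmf_fps V) (pmf_fps eps)"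
proof -
  have supp: "(b, c) \<in> set_pmf (map_pmf (\<lambda>s. (B s, C s)) p) \<longleftrightarrow> (\<exists>a. 0 < pmf p (h a b c))" for b c
  proof -
    have "(b, c) \<in> set_pmf (map_pmf (\<lambda>s. (B s, C s)) p) \<longleftrightarrow> (\<exists>s\<in>set_pmf p. B s = b \<and> C s = c)"
      by force
    also have "\<dots> \<longleftrightarrow> (\<exists>a. h a b c \<in> set_pmf p)"
      by (metis h ABC)
    finally show ?thesis
      by (simp add: pmf_positive_iff)
  qed
  have row: "map_pmf A (cond_pmf p {s. B s = b \<and> C s = c}) = compound_pmf W V eps b c \<longleftrightarrow>
      (\<exists>k. \<forall>a. pmf p (h a b c) = k * fps_nth (pmf_fps W ^ b * pmf_fps V ^ c * pmf_fps eps) a)"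
    if ex: "\<exists>a. 0 < pmf p (h a b c)" for b c
  proof -
    let ?S = "{s. B s = b \<and> C s = c}"
    from ex obtain a0 where a0: "0 < pmf p (h a0 b c)" ..
    note cond = pmf_map_cond_pmf_coordinates(1)[where h = h and A = A and B = B and C = C, OF h ABC a0]
    note m = pmf_map_cond_pmf_coordinates(2)[where h = h and A = A and B = B and C = C, OF h ABC a0]
    have comp: "pmf (compound_pmf W V eps b c) a
        = fps_nth (pmf_fps W ^ b * pmf_fps V ^ c * pmf_fps eps) a" for a
      by (metis pmf_fps_nth pmf_fps_compound)
    show ?thesis
    proof
      assume "map_pmf A (cond_pmf p ?S) = compound_pmf W V eps b c"
      then have "pmf p (h a b c) / measure p ?S
          = fps_nth (pmf_fps W ^ b * pmf_fps V ^ c * pmf_fps eps) a" for a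
        using cond[of a] comp[of a] by simp
      then show "\<exists>k. \<forall>a. pmf p (h a b c)
          = k * fps_nth (pmf_fps W ^ b * pmf_fps V ^ c * pmf_fps eps) a"
        using m by (intro exI[of _ "measure p ?S"]) (simp add: field_simps)
    next
      assume "\<exists>k. \<forall>a. pmf p (h a b c)
          = k * fps_nth (pmf_fps W ^ b * pmf_fps V ^ c * pmf_fps eps) a"
      then obtain k where "\<And>a. pmf p (h a b c)
          = k * fps_nth (pmf_fps W ^ b * pmf_fps V ^ c * pmf_fps eps) a"
        by blast
      then show "map_pmf A (cond_pmf p ?S) = compound_pmf W V eps b c"
        by (intro pmf_eqI_proportional[of _ "k / measure p ?S"]) (simp add: cond comp)
    qed
  qed
  show ?thesis
    unfolding conditionally_compound_def proportional_rows_def using supp row by blast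
qed

section \<open>Compatible normalized rows are negative multinomial\<close>

text \<open>The power series of \<open>(1 - \<rho>X) powr (- a)\<close>.\<close>

definition negbin_fps :: "real \<Rightarrow> real \<Rightarrow> real fps" where
  "negbin_fps a \<rho> = Abs_fps (\<lambda>n. pochhammer a n / fact n * \<rho> ^ n)"

lemma negbin_fps_nth [simp]: "fps_nth (negbin_fps a \<rho>) n = pochhammer a n / fact n * \<rho> ^ n"
  by (simp add: negbin_fps_def)

text \<open>Substituting into the binomial series transfers its law of exponents to
  \<open>negbin_fps\<close>.\<close>

lemma negbin_fps_conv_binomial:
  "negbin_fps a \<rho> = fps_binomial (- a) oo (fps_const (- \<rho>) * fps_X)"
proof (rule fps_ext)
  fix n
  have "(- 1) ^ n * (- \<rho>) ^ n = \<rho> ^ n"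
    by (simp add: power_mult_distrib[symmetric])
  then show "fps_nth (negbin_fps a \<rho>) n
      = fps_nth (fps_binomial (- a) oo (fps_const (- \<rho>) * fps_X)) n"
    by (simp only: fps_nth_compose_linear negbin_fps_nth fps_binomial_nth)
       (simp add: gbinomial_pochhammer mult.left_commute)
qed

lemma negbin_fps_add: "negbin_fps (a + b) \<rho> = negbin_fps a \<rho> * negbin_fps b \<rho>"
proof -
  have "- (a + b) = - a + - b" by simp
  then show ?thesis
    unfolding negbin_fps_conv_binomial
    by (simp only: fps_binomial_add_mult) (simp add: fps_compose_mult_distrib)
qed

lemma negbin_fps_0: "negbin_fps 0 \<rho> = 1"
  by (rule fps_ext) (simp add: pochhammer_0_left)

lemma negbin_fps_power: "negbin_fps a \<rho> ^ n = negbin_fps (real n * a) \<rho>"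
  by (induction n) (simp_all add: negbin_fps_0 negbin_fps_add distrib_right)

section \<open>Differential equations determining the row series\<close>

lemma fps_X_deriv_nth: "fps_nth (fps_X * fps_deriv f) n = of_nat n * fps_nth f n"
  by (cases n) auto

text \<open>At index \<open>n\<close> the two outer terms of the convolution give twice the
  coefficient, and the derivative gives \<open>n\<close> times it. What remains equates
  \<open>n - 1\<close> times the coefficient with a sum of \<open>n - 1\<close> inner products, each
  equal to \<open>fps_nth A 1 ^ n\<close> by induction. For \<open>n = 1\<close> this is void, so
  the linear coefficient stays free.\<close>

lemma logistic_fps_eq_geometric:
  fixes A :: "real fps"
  assumes A0: "fps_nth A 0 = 1" and ode: "A * A = A + fps_X * fps_deriv A"
  shows "A = negbin_fps 1 (fps_nth A 1)"
proof -
  have "fps_nth A n = fps_nth A 1 ^ n" for n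
  proof (induction n rule: less_induct)
    case (less n)
    show ?case
    proof (cases "n \<le> 1")
      case True
      then show ?thesis using A0 by (cases n) auto
    next
      case False
      then have n: "2 \<le> n" by simp
      define S where "S = {1..n-1}"
      have S: "finite S" "0 \<notin> S" "n \<notin> S" "card S = n - 1"
        using n by (auto simp: S_def)
      have "(1 + real n) * fps_nth A n = fps_nth (A * A) n"
        unfolding ode fps_add_nth fps_X_deriv_nth by (simp add: algebra_simps)
      also have "\<dots> = (\<Sum>i=0..n. fps_nth A i * fps_nth A (n - i))"
        by (rule fps_mult_nth)
      also have "{0..n} = insert 0 (insert n S)"
        using n by (auto simp: S_def)
      also have "(\<Sum>i\<in>insert 0 (insert n S). fps_nth A i * fps_nth A (n - i))
          = 2 * fps_nth A n + (\<Sum>i\<in>S. fps_nth A i * fps_nth A (n - i))"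
        using n A0 S by simp
      also have "(\<Sum>i\<in>S. fps_nth A i * fps_nth A (n - i)) = (\<Sum>i\<in>S. fps_nth A 1 ^ n)"
      proof (rule sum.cong)
        fix i assume "i \<in> S"
        then have i: "i < n" "n - i < n" "i + (n - i) = n"
          using n by (auto simp: S_def)
        show "fps_nth A i * fps_nth A (n - i) = fps_nth A 1 ^ n"
          unfolding less.IH[OF i(1)] less.IH[OF i(2)] power_add[symmetric] i(3) ..
      qed simp
      also have "\<dots> = (real n - 1) * fps_nth A 1 ^ n"
        using n S by (simp add: of_nat_diff)
      finally have "(real n - 1) * fps_nth A n = (real n - 1) * fps_nth A 1 ^ n"
        by (simp add: algebra_simps)
      then show ?thesis using n by simp
    qed
  qed
  note * = this
  show ?thesis
    by (rule fps_ext) (subst *, simp flip: pochhammer_fact)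
qed

text \<open>Expanding the derivative of \<open>A * e\<close> in the second equation and eliminating
  the derivative of \<open>e\<close> by the first leaves the logistic equation for \<open>A\<close>,
  multiplied by the cancellable factor \<open>fps_const \<kappa> * e\<close>. With \<open>A\<close>
  geometric, the first equation becomes a recurrence for \<open>e\<close>.\<close>

lemma negbin_fps_characterization:
  fixes A e :: "real fps"
  assumes \<kappa>: "\<kappa> \<noteq> 0" and A0: "fps_nth A 0 = 1" and e0: "fps_nth e 0 = 1"
    and 1: "A * e = e + fps_const \<kappa> * (fps_X * fps_deriv e)"
    and 2: "fps_const (1 + \<kappa>) * (A * (A * e))
      = fps_const (1 + \<kappa>) * (A * e) + fps_const \<kappa> * (fps_X * fps_deriv (A * e))"
  shows "A = negbin_fps 1 (fps_nth A 1)" "e = negbin_fps (1 / \<kappa>) (fps_nth A 1)"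
proof -
  let ?k = "fps_const \<kappa>"
  have e_ne: "e \<noteq> 0" using e0 by auto
  have "fps_const (1 + \<kappa>) = 1 + ?k"
    by (metis fps_const_1_eq_1 fps_const_add)
  with 2 have "(1 + ?k) * (A * (A * e))
      = (1 + ?k) * (A * e) + ?k * (fps_X * fps_deriv A * e) + A * (?k * (fps_X * fps_deriv e))"
    by (simp add: algebra_simps)
  moreover have "?k * (fps_X * fps_deriv e) = A * e - e"
    using 1 by simp
  ultimately have "(1 + ?k) * (A * (A * e))
      = (1 + ?k) * (A * e) + ?k * (fps_X * fps_deriv A * e) + A * (A * e - e)"
    by simp
  then have "(?k * e) * (A * A) = (?k * e) * (A + fps_X * fps_deriv A)"
    by (simp add: algebra_simps)
  then have "A * A = A + fps_X * fps_deriv A"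
    using e_ne \<kappa> by simp
  with A0 show A: "A = negbin_fps 1 (fps_nth A 1)"
    by (rule logistic_fps_eq_geometric)
  define \<rho> where "\<rho> = fps_nth A 1"
  have A_nth: "fps_nth A n = \<rho> ^ n" for n
    by (subst A) (simp add: \<rho>_def flip: pochhammer_fact)
  \<comment> \<open>A geometric series in fixed-point form; multiplied by \<open>e\<close>, it links
    consecutive coefficients of \<open>A * e\<close> without a division of series.\<close>
  have "A = 1 + fps_const \<rho> * fps_X * A"
  proof (rule fps_ext)
    fix n show "fps_nth A n = fps_nth (1 + fps_const \<rho> * fps_X * A) n"
      by (cases n) (simp_all add: A_nth mult.assoc)
  qed
  then have "A * e = e + fps_const \<rho> * (fps_X * (A * e))"
    by (metis (no_types, opaque_lifting) distrib_right mult.assoc mult_1)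
  then have "fps_nth (A * e) (Suc n) = fps_nth e (Suc n) + \<rho> * fps_nth (A * e) n" for n
    by (metis fps_add_nth fps_mult_left_const_nth fps_X_mult_nth diff_Suc_1 nat.distinct(1))
  \<comment> \<open>The first equation gives these coefficients in terms of \<open>e\<close>, so the
    recurrence for \<open>A * e\<close> becomes one for \<open>e\<close> alone.\<close>
  moreover have Ae: "fps_nth (A * e) n = (1 + \<kappa> * n) * fps_nth e n" for n
    unfolding 1 fps_add_nth fps_mult_left_const_nth fps_X_deriv_nth by (simp add: algebra_simps)
  ultimately have "\<kappa> * real (Suc n) * fps_nth e (Suc n) = \<rho> * ((1 + \<kappa> * n) * fps_nth e n)" for n
    by (simp only: Ae) (simp add: algebra_simps)
  then have step: "fps_nth e (Suc n) = \<rho> * (1 / \<kappa> + n) / real (Suc n) * fps_nth e n" for n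
    using \<kappa> by (simp add: field_simps del: of_nat_Suc)
  have "fps_nth e n = fps_nth (negbin_fps (1 / \<kappa>) \<rho>) n" for n
  proof (induction n)
    case 0
    then show ?case using e0 by simp
  next
    case (Suc n)
    then show ?case
      by (simp add: step pochhammer_Suc mult_ac del: of_nat_Suc)
  qed
  then show "e = negbin_fps (1 / \<kappa>) (fps_nth A 1)"
    by (simp add: fps_eq_iff \<rho>_def)
qed

section \<open>Low-order coefficients of rows and negative multinomial coefficients\<close>

lemma fps_nth_power_mult_0:
  "fps_nth (f ^ m * g ^ n * e) 0 = fps_nth f 0 ^ m * fps_nth g 0 ^ n * fps_nth (e :: real fps) 0"
  by (simp add: fps_power_zeroth)

lemma fps_nth_power_1:
  fixes f :: "real fps"
  assumes "fps_nth f 0 = 1"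
  shows "fps_nth (f ^ n) 1 = n * fps_nth f 1"
  by (induction n) (use assms in \<open>auto simp: fps_mult_nth_1 fps_power_zeroth algebra_simps\<close>)

lemma fps_nth_power_mult_1:
  fixes f g e :: "real fps"
  assumes "fps_nth f 0 = 1" "fps_nth g 0 = 1" "fps_nth e 0 = 1"
  shows "fps_nth (f ^ m * g ^ n * e) 1 = fps_nth e 1 + m * fps_nth f 1 + n * fps_nth g 1"
  using assms fps_nth_power_1[of f m] fps_nth_power_1[of g n]
  by (simp add: fps_mult_nth_1 fps_power_zeroth algebra_simps)

text \<open>These are the coefficients of \<open>u^x v^y t^z\<close> in
  \<open>(1 - \<rho>1 u - \<rho>2 v - \<rho>3 t) powr (- a)\<close>, that is, negative multinomial
  probabilities up to a constant factor.\<close>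

definition negmult_coeff ::
  "real \<Rightarrow> real \<Rightarrow> real \<Rightarrow> real \<Rightarrow> nat \<Rightarrow> nat \<Rightarrow> nat \<Rightarrow> real" where
  "negmult_coeff a \<rho>1 \<rho>2 \<rho>3 x y z =
     pochhammer a (x + y + z) * \<rho>1 ^ x * \<rho>2 ^ y * \<rho>3 ^ z / (fact x * fact y * fact z)"

text \<open>The rising factorial of length \<open>x + y + z\<close> splits after its first
  \<open>y + z\<close> factors; the others start at \<open>a + (y + z)\<close>.\<close>

lemma negmult_coeff_row:
  "negmult_coeff a \<rho>1 \<rho>2 \<rho>3 x y z = negmult_coeff a \<rho>1 \<rho>2 \<rho>3 0 y z
     * fps_nth (negbin_fps (a + real (y + z)) \<rho>1) x"
  using pochhammer_product'[of a "y + z" x]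
  by (simp add: negmult_coeff_def mult_ac add_ac)

lemma negmult_coeff_swap12: "negmult_coeff a \<rho>1 \<rho>2 \<rho>3 x y z = negmult_coeff a \<rho>2 \<rho>1 \<rho>3 y x z"
  by (simp add: negmult_coeff_def mult_ac add_ac)

lemma negmult_coeff_swap23: "negmult_coeff a \<rho>1 \<rho>2 \<rho>3 x y z = negmult_coeff a \<rho>1 \<rho>3 \<rho>2 x z y"
  by (simp add: negmult_coeff_def mult_ac add_ac)

lemma negmult_coeff_pos:
  assumes "0 < a" "0 < \<rho>1" "0 < \<rho>2" "0 < \<rho>3"
  shows "0 < negmult_coeff a \<rho>1 \<rho>2 \<rho>3 x y z"
  using assms by (simp add: negmult_coeff_def pochhammer_pos)

text \<open>Constant terms equal to 1 make the factor of each row its entry at 0, so no existential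
  constant is left. Nonconstancy of the summands survives as \<open>nontriv\<close>; nonnegativity
  of coefficients is not assumed.\<close>

locale normalized_rows =
  fixes r :: "nat \<Rightarrow> nat \<Rightarrow> nat \<Rightarrow> real" and a1 a2 a3 a4 a5 a6 e1 e2 e3 :: "real fps"
  assumes pos: "0 < r x y z"
    and row1: "r x y z = r 0 y z * fps_nth (a1 ^ y * a2 ^ z * e1) x"
    and row2: "r x y z = r x 0 z * fps_nth (a3 ^ x * a4 ^ z * e2) y"
    and row3: "r x y z = r x y 0 * fps_nth (a5 ^ x * a6 ^ y * e3) z"
    and zeroth: "fps_nth a1 0 = 1" "fps_nth a2 0 = 1" "fps_nth a3 0 = 1" "fps_nth a4 0 = 1"
      "fps_nth a5 0 = 1" "fps_nth a6 0 = 1" "fps_nth e1 0 = 1" "fps_nth e2 0 = 1" "fps_nth e3 0 = 1"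
    and nontriv: "a1 \<noteq> 1" "a2 \<noteq> 1" "a3 \<noteq> 1" "a4 \<noteq> 1" "a5 \<noteq> 1" "a6 \<noteq> 1"
begin

text \<open>Permuting the coordinates yields the same locale with permuted series, so every fact
  about the first coordinate also covers the other two.\<close>

lemma swap23: "normalized_rows (\<lambda>x y z. r x z y) a2 a1 a5 a6 a3 a4 e1 e3 e2"
proof
  show "r x z y = r 0 z y * fps_nth (a2 ^ y * a1 ^ z * e1) x" for x y z
    by (subst row1) (simp only: mult.commute)
qed (rule pos row2 row3 zeroth nontriv)+

lemma swap12: "normalized_rows (\<lambda>x y z. r y x z) a3 a4 a1 a2 a6 a5 e2 e1 e3"
proof
  show "r y x z = r y x 0 * fps_nth (a6 ^ x * a5 ^ y * e3) z" for x y z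
    by (subst row3) (simp only: mult.commute)
qed (rule pos row1 row2 zeroth nontriv)+

lemma lin1: "r 1 y z = r 0 y z * (fps_nth e1 1 + y * fps_nth a1 1 + z * fps_nth a2 1)"
  using row1[of 1 y z] fps_nth_power_mult_1[of a1 a2 e1 y z] zeroth by simp

lemma lin2: "r x 1 z = r x 0 z * (fps_nth e2 1 + x * fps_nth a3 1 + z * fps_nth a4 1)"
  using row2[of x 1 z] fps_nth_power_mult_1[of a3 a4 e2 x z] zeroth by simp

lemma lin3: "r x y 1 = r x y 0 * (fps_nth e3 1 + x * fps_nth a5 1 + y * fps_nth a6 1)"
  using row3[of x y 1] fps_nth_power_mult_1[of a5 a6 e3 x y] zeroth by simp

lemma lin1_pos: "0 < fps_nth e1 1 + real y * fps_nth a1 1 + real z * fps_nth a2 1"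
  using lin1[of y z] pos[of 1 y z] pos[of 0 y z] by (simp add: zero_less_mult_iff)

lemma e1_pos: "0 < fps_nth e1 1"
  using lin1_pos[of 0 0] by simp

lemma e3_pos: "0 < fps_nth e3 1"
  using lin3[of 0 0] pos[of 0 0 0] pos[of 0 0 1] by (simp add: zero_less_mult_iff)

text \<open>From \<open>r 0 y 0\<close> the entry \<open>r 1 y 1\<close> is reached by raising
  \<open>x\<close> and then \<open>z\<close>, or in the other order. The two products agree for
  every \<open>y\<close>; after cancellation both sides are affine in \<open>y\<close>, and
  \<open>y = 0\<close> and \<open>y = 1\<close> give the two identities.\<close>

lemma cross:
  shows "fps_nth e1 1 * fps_nth a5 1 = fps_nth e3 1 * fps_nth a2 1"
    and "fps_nth a1 1 * fps_nth a5 1 = fps_nth a6 1 * fps_nth a2 1"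
proof -
  have *: "(fps_nth e1 1 + y * fps_nth a1 1) * (fps_nth e3 1 + fps_nth a5 1 + y * fps_nth a6 1)
      = (fps_nth e3 1 + y * fps_nth a6 1) * (fps_nth e1 1 + y * fps_nth a1 1 + fps_nth a2 1)"
    for y :: nat
  proof -
    have "r 0 y 0 * ((fps_nth e1 1 + y * fps_nth a1 1)
          * (fps_nth e3 1 + fps_nth a5 1 + y * fps_nth a6 1)) = r 1 y 1"
      using lin3[of 1 y] lin1[of y 0] by simp
    also have "\<dots> = r 0 y 0 * ((fps_nth e3 1 + y * fps_nth a6 1)
          * (fps_nth e1 1 + y * fps_nth a1 1 + fps_nth a2 1))"
      using lin1[of y 1] lin3[of 0 y] by simp
    finally show ?thesis using pos[of 0 y 0] by simp
  qed
  show 1: "fps_nth e1 1 * fps_nth a5 1 = fps_nth e3 1 * fps_nth a2 1"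
    using *[of 0] by (simp add: algebra_simps)
  show "fps_nth a1 1 * fps_nth a5 1 = fps_nth a6 1 * fps_nth a2 1"
    using *[of 1] 1 by (simp add: algebra_simps)
qed

text \<open>The entry \<open>r x 0 1\<close> is computed along \<open>x\<close> and along
  \<open>z\<close>. This is the first differential equation in coefficient form, before the slopes
  are known to agree.\<close>

lemma a2_e1_nth:
  "fps_nth e3 1 * fps_nth (a2 * e1) x = fps_nth e1 x * (fps_nth e3 1 + x * fps_nth a5 1)"
proof -
  have "r 0 0 0 * (fps_nth e3 1 * fps_nth (a2 * e1) x) = r x 0 1"
    using row1[of x 0 1] lin3[of 0 0] by simp
  also have "\<dots> = r 0 0 0 * (fps_nth e1 x * (fps_nth e3 1 + x * fps_nth a5 1))"
    using row1[of x 0 0] lin3[of x 0] by simp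
  finally show ?thesis using pos[of 0 0 0] by simp
qed

text \<open>A series different from 1 may still have linear coefficient 0. Here that would give
  \<open>a2 * e1 = e1\<close>, hence \<open>a2 = 1\<close>.\<close>

lemma a5_nonzero: "fps_nth a5 1 \<noteq> 0"
proof
  assume "fps_nth a5 1 = 0"
  then have "fps_nth (a2 * e1) x = fps_nth (1 * e1) x" for x
    using a2_e1_nth[of x] e3_pos by simp
  then have "a2 * e1 = 1 * e1"
    by (rule fps_ext)
  moreover have "e1 \<noteq> 0" using zeroth by auto
  ultimately show False using nontriv by (metis mult_right_cancel)
qed

text \<open>Divide each linear coefficient of \<open>a1\<close>, ..., \<open>a6\<close> by that of
  the matching \<open>e\<close> and call the quotients k1, ..., k6. The first identities of
  \<open>cross\<close> give k2 = k5, k1 = k3 and k4 = k6. The product identities, after nonzero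
  slopes are cancelled, give k1 = k6 and k2 = k4, so all six agree.\<close>

lemma slopes:
  "\<exists>\<kappa>>0. fps_nth a1 1 = \<kappa> * fps_nth e1 1 \<and> fps_nth a2 1 = \<kappa> * fps_nth e1 1 \<and>
    fps_nth a3 1 = \<kappa> * fps_nth e2 1 \<and> fps_nth a4 1 = \<kappa> * fps_nth e2 1 \<and>
    fps_nth a5 1 = \<kappa> * fps_nth e3 1 \<and> fps_nth a6 1 = \<kappa> * fps_nth e3 1"
proof -
  interpret s23: normalized_rows "\<lambda>x y z. r x z y" a2 a1 a5 a6 a3 a4 e1 e3 e2
    by (rule swap23)
  interpret s12: normalized_rows "\<lambda>x y z. r y x z" a3 a4 a1 a2 a6 a5 e2 e1 e3
    by (rule swap12)
  define \<kappa> where "\<kappa> = fps_nth a1 1 / fps_nth e1 1"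
  note p = e1_pos e3_pos s12.e1_pos
  note nz = a5_nonzero s23.a5_nonzero s12.a5_nonzero
  note c = cross s23.cross s12.cross
  have a1: "fps_nth a1 1 = \<kappa> * fps_nth e1 1"
    using p by (simp add: \<kappa>_def)
  have a3: "fps_nth a3 1 = \<kappa> * fps_nth e2 1"
    using c(3) p by (simp add: \<kappa>_def field_simps)
  have k0: "\<kappa> \<noteq> 0" using a3 nz by auto
  have a2_ne: "fps_nth a2 1 \<noteq> 0" using c(1) p nz by auto
  have a5: "fps_nth a5 1 = fps_nth a2 1 / fps_nth e1 1 * fps_nth e3 1"
    using c(1) p by (simp add: field_simps)
  have a6: "fps_nth a6 1 = \<kappa> * fps_nth e3 1"
    using c(2) a2_ne p unfolding a5 a1 by (simp add: field_simps)
  have a4: "fps_nth a4 1 = fps_nth a2 1 / fps_nth e1 1 * fps_nth e2 1"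
    using c(4) k0 p unfolding a3 a1 by (simp add: field_simps)
  have a2: "fps_nth a2 1 = \<kappa> * fps_nth e1 1"
    using c(5) p unfolding a6 a4 by (simp add: field_simps)
  \<comment> \<open>With a negative slope the affine function of \<open>lin1_pos\<close> would
    become negative for large \<open>y\<close>.\<close>
  have "0 < \<kappa>"
  proof (rule ccontr)
    assume "\<not> 0 < \<kappa>"
    then have "0 < - \<kappa>" using k0 by simp
    from reals_Archimedean3[OF this] obtain n where n: "1 < real n * (- \<kappa>)"
      by blast
    have "0 < fps_nth e1 1 * (1 + real n * \<kappa>)"
      using lin1_pos[of n 0] unfolding a1 by (simp add: algebra_simps)
    then show False using n p by (simp add: zero_less_mult_iff)
  qed
  moreover have q: "fps_nth a2 1 / fps_nth e1 1 = \<kappa>"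
    using a2 p by simp
  ultimately show ?thesis
    using a1 a2 a3 a4[unfolded q] a5[unfolded q] a6 by (intro exI[of _ \<kappa>] conjI)
qed

text \<open>Equal slopes turn \<open>a2_e1_nth\<close> and its mirror image into the same equation,
  whence \<open>a1 = a2\<close>; the entries \<open>r x 1 1\<close> provide the second equation
  needed for \<open>negbin_fps_characterization\<close>.\<close>

lemma negbin_row:
  assumes "0 < \<kappa>"
    "fps_nth a1 1 = \<kappa> * fps_nth e1 1" "fps_nth a2 1 = \<kappa> * fps_nth e1 1"
    "fps_nth a3 1 = \<kappa> * fps_nth e2 1" "fps_nth a4 1 = \<kappa> * fps_nth e2 1"
    "fps_nth a5 1 = \<kappa> * fps_nth e3 1"
  shows "r x y z = r 0 y z
    * fps_nth (negbin_fps (1 / \<kappa> + real (y + z)) (\<kappa> * fps_nth e1 1)) x"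
proof -
  interpret s23: normalized_rows "\<lambda>x y z. r x z y" a2 a1 a5 a6 a3 a4 e1 e3 e2
    by (rule swap23)
  note p = e3_pos s23.e3_pos
  have a2e: "fps_nth (a2 * e1) x = (1 + \<kappa> * x) * fps_nth e1 x" for x
  proof -
    have "fps_nth e3 1 * fps_nth (a2 * e1) x = fps_nth e3 1 * ((1 + \<kappa> * x) * fps_nth e1 x)"
      using a2_e1_nth[of x] unfolding assms by (simp add: algebra_simps)
    then show ?thesis using p by simp
  qed
  have a1e: "fps_nth (a1 * e1) x = (1 + \<kappa> * x) * fps_nth e1 x" for x
  proof -
    have "fps_nth e2 1 * fps_nth (a1 * e1) x = fps_nth e2 1 * ((1 + \<kappa> * x) * fps_nth e1 x)"
      using s23.a2_e1_nth[of x] unfolding assms by (simp add: algebra_simps)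
    then show ?thesis using p by simp
  qed
  have "a1 * e1 = a2 * e1"
    by (rule fps_ext) (simp only: a1e a2e)
  moreover have "e1 \<noteq> 0" using zeroth by auto
  ultimately have a12: "a1 = a2" by simp
  have "fps_nth (fps_const (1 + \<kappa>) * (a2 * (a2 * e1))) x
      = (1 + \<kappa> + \<kappa> * x) * fps_nth (a2 * e1) x" for x
  proof -
    \<comment> \<open>The entry \<open>r x 1 1\<close> is reached from \<open>r 0 1 1\<close> along
      \<open>x\<close> and from \<open>r x 0 1\<close> along \<open>y\<close>.\<close>
    have "r 0 0 1 * fps_nth e2 1 * ((1 + \<kappa>) * fps_nth (a2 * (a2 * e1)) x) = r x 1 1"
      using row1[of x 1 1] lin2[of 0 1] unfolding assms a12 by (simp add: algebra_simps)
    also have "\<dots> = r 0 0 1 * fps_nth e2 1 * ((1 + \<kappa> + \<kappa> * x) * fps_nth (a2 * e1) x)"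
      using row1[of x 0 1] lin2[of x 1] unfolding assms by (simp add: algebra_simps)
    finally show ?thesis using pos[of 0 0 1] p by simp
  qed
  then have 2: "fps_const (1 + \<kappa>) * (a2 * (a2 * e1))
      = fps_const (1 + \<kappa>) * (a2 * e1) + fps_const \<kappa> * (fps_X * fps_deriv (a2 * e1))"
    by (intro fps_ext) (simp only: fps_add_nth fps_mult_left_const_nth fps_X_deriv_nth, simp only: distrib_right mult.assoc)
  have 1: "a2 * e1 = e1 + fps_const \<kappa> * (fps_X * fps_deriv e1)"
    by (rule fps_ext)
       (simp only: a2e fps_add_nth fps_mult_left_const_nth fps_X_deriv_nth, simp add: algebra_simps)
  have A: "a2 = negbin_fps 1 (\<kappa> * fps_nth e1 1)" "e1 = negbin_fps (1 / \<kappa>) (\<kappa> * fps_nth e1 1)"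
    using negbin_fps_characterization[OF _ _ _ 1 2] assms zeroth by simp_all
  define \<rho> where "\<rho> = \<kappa> * fps_nth e1 1"
  have "a1 ^ y * a2 ^ z * e1 = negbin_fps (1 / \<kappa> + real (y + z)) \<rho>"
    unfolding a12 using A[folded \<rho>_def]
    by (simp add: negbin_fps_power flip: negbin_fps_add) (simp add: add.commute)
  then show ?thesis
    using row1[of x y z] by (simp add: \<rho>_def)
qed

text \<open>The coordinates are lowered to 0 one after another by \<open>negbin_row\<close> and its
  permuted copies. The three rising factorials join into
  \<open>pochhammer a (x + y + z)\<close>.\<close>

lemma negative_multinomial:
  obtains a \<rho>1 \<rho>2 \<rho>3 where "0 < a" "0 < \<rho>1" "0 < \<rho>2" "0 < \<rho>3"
    "\<And>x y z. r x y z = r 0 0 0 * negmult_coeff a \<rho>1 \<rho>2 \<rho>3 x y z"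
proof -
  obtain \<kappa> where k: "0 < \<kappa>"
    "fps_nth a1 1 = \<kappa> * fps_nth e1 1" "fps_nth a2 1 = \<kappa> * fps_nth e1 1"
    "fps_nth a3 1 = \<kappa> * fps_nth e2 1" "fps_nth a4 1 = \<kappa> * fps_nth e2 1"
    "fps_nth a5 1 = \<kappa> * fps_nth e3 1" "fps_nth a6 1 = \<kappa> * fps_nth e3 1"
    using slopes by blast
  interpret s12: normalized_rows "\<lambda>x y z. r y x z" a3 a4 a1 a2 a6 a5 e2 e1 e3
    by (rule swap12)
  interpret s13: normalized_rows "\<lambda>x y z. r z y x" a6 a5 a4 a3 a2 a1 e3 e2 e1
    by (rule normalized_rows.swap12[OF normalized_rows.swap23[OF swap12]])
  note n1 = negbin_row[OF k(1-6)]
  note n2 = s12.negbin_row[OF k(1,4,5,2,3,7)]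
  note n3 = s13.negbin_row[OF k(1,7,6,5,4,3)]
  define a \<rho>1 \<rho>2 \<rho>3 where "a = 1 / \<kappa>" "\<rho>1 = \<kappa> * fps_nth e1 1" "\<rho>2 = \<kappa> * fps_nth e2 1" "\<rho>3 = \<kappa> * fps_nth e3 1"
  have "r x y z = r 0 0 0 * negmult_coeff a \<rho>1 \<rho>2 \<rho>3 x y z" for x y z
  proof -
    note defs = a_\<rho>1_\<rho>2_\<rho>3_def
    have "r x y z = r 0 y z * (pochhammer (a + (z + y)) x / fact x * \<rho>1 ^ x)"
      using n1[of x y z] by (simp add: defs add.commute[of "real y"])
    moreover have "r 0 y z = r 0 0 z * (pochhammer (a + z) y / fact y * \<rho>2 ^ y)"
      using n2[where x = y and y = 0 and z = z] by (simp add: defs)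
    moreover have "r 0 0 z = r 0 0 0 * (pochhammer a z / fact z * \<rho>3 ^ z)"
      using n3[where x = z and y = 0 and z = 0] by (simp add: defs)
    moreover have "pochhammer a (x + y + z)
        = pochhammer a z * pochhammer (a + z) y * pochhammer (a + (z + y)) x"
      using pochhammer_product'[of a "z + y" x] pochhammer_product'[of a z y]
      by (simp add: add_ac)
    ultimately show ?thesis
      by (simp add: negmult_coeff_def mult_ac)
  qed
  note eq = this
  have "0 < a" "0 < \<rho>1" "0 < \<rho>2" "0 < \<rho>3"
    using k(1) e1_pos e3_pos s12.e1_pos by (simp_all add: a_\<rho>1_\<rho>2_\<rho>3_def)
  from this eq show ?thesis by (rule that)
qed

end

section \<open>Positivity and normalization\<close>

lemma fps_mult_nth_pos:
  fixes f g :: "real fps"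
  assumes "\<And>n. 0 \<le> fps_nth f n" "\<And>n. 0 \<le> fps_nth g n" "0 < fps_nth f i" "0 < fps_nth g j"
  shows "0 < fps_nth (f * g) (i + j)"
  unfolding fps_mult_nth
  by (rule sum_pos2[of _ i]) (use assms in auto)

lemma fps_mult_nth_nonneg:
  fixes f g :: "real fps"
  assumes "\<And>n. 0 \<le> fps_nth f n" "\<And>n. 0 \<le> fps_nth g n"
  shows "0 \<le> fps_nth (f * g) n"
  unfolding fps_mult_nth using assms by (intro sum_nonneg) auto

lemma fps_power_nth_nonneg:
  fixes f :: "real fps"
  assumes "\<And>n. 0 \<le> fps_nth f n"
  shows "0 \<le> fps_nth (f ^ m) n"
  by (induction m arbitrary: n) (auto simp: fps_one_nth intro!: fps_mult_nth_nonneg assms)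

lemma fps_power_nth_pos:
  fixes f :: "real fps"
  assumes "\<And>n. 0 \<le> fps_nth f n" "0 < fps_nth f i"
  shows "0 < fps_nth (f ^ m) (m * i)"
proof (induction m)
  case (Suc m)
  then show ?case
    using fps_mult_nth_pos[OF assms(1) fps_power_nth_nonneg[OF assms(1)] assms(2) Suc.IH] by simp
qed simp

lemma fps_power_mult_nth_pos:
  fixes f g e :: "real fps"
  assumes "\<And>n. 0 \<le> fps_nth f n" "\<And>n. 0 \<le> fps_nth g n" "\<And>n. 0 \<le> fps_nth e n"
    and "0 < fps_nth f i" "0 < fps_nth g j" "0 < fps_nth e k"
  shows "0 < fps_nth (f ^ m * g ^ n * e) (m * i + n * j + k)"
  by (intro fps_mult_nth_pos fps_mult_nth_nonneg fps_power_nth_pos fps_power_nth_nonneg assms)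

lemma fps_power_mult_nth_eq_0:
  fixes f :: "real fps"
  assumes "fps_nth f 0 = 0" "n < m"
  shows "fps_nth (f ^ m * g) n = 0"
  unfolding fps_mult_nth
  using startsby_zero_power_prefix[OF assms(1), of m] assms(2) by (intro sum.neutral) auto

lemma fps_unscale_power:
  fixes c :: real
  assumes "c \<noteq> 0"
  shows "f ^ n = fps_const (c ^ n) * (fps_const (1 / c) * f) ^ n"
proof -
  have "fps_const c * (fps_const (1 / c) * f) = f"
    using assms by (simp flip: mult.assoc)
  then show ?thesis
    by (metis fps_const_power power_mult_distrib)
qed

lemma proportional_rows_commute:
  "proportional_rows s f g e \<Longrightarrow> proportional_rows (\<lambda>x y z. s x z y) g f e"
  unfolding proportional_rows_def by (simp only: mult.commute) blast

lemma scaled_neq_1: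
  fixes f :: "real fps"
  assumes "\<exists>i>0. 0 < fps_nth f i" "0 < c"
  shows "fps_const (1 / c) * f \<noteq> 1"
proof -
  from assms obtain i where "0 < i" "fps_nth (fps_const (1 / c) * f) i \<noteq> fps_nth 1 i"
    by auto
  then show ?thesis by metis
qed

text \<open>Only what the comparison of supports needs is kept from the probabilistic setting. The
  positive index in \<open>f_pos\<close> expresses nonconstancy, and the range conditions express
  that each count variable attains every value.\<close>

locale compatible_rows =
  fixes r :: "nat \<Rightarrow> nat \<Rightarrow> nat \<Rightarrow> real" and f1 f2 f3 f4 f5 f6 e1 e2 e3 :: "real fps"
  assumes r_nonneg: "0 \<le> r x y z"
    and rows1: "proportional_rows r f1 f2 e1"
    and rows2: "proportional_rows (\<lambda>y x z. r x y z) f3 f4 e2"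
    and rows3: "proportional_rows (\<lambda>z x y. r x y z) f5 f6 e3"
    and range1: "\<exists>y z. 0 < r x y z"
    and range2: "\<exists>x z. 0 < r x y z"
    and range3: "\<exists>x y. 0 < r x y z"
    and f_nonneg: "0 \<le> fps_nth f1 n" "0 \<le> fps_nth f2 n" "0 \<le> fps_nth f3 n"
      "0 \<le> fps_nth f4 n" "0 \<le> fps_nth f5 n" "0 \<le> fps_nth f6 n"
    and e_nonneg: "0 \<le> fps_nth e1 n" "0 \<le> fps_nth e2 n" "0 \<le> fps_nth e3 n"
    and f_pos: "\<exists>i>0. 0 < fps_nth f1 i" "\<exists>i>0. 0 < fps_nth f2 i" "\<exists>i>0. 0 < fps_nth f3 i"
      "\<exists>i>0. 0 < fps_nth f4 i" "\<exists>i>0. 0 < fps_nth f5 i" "\<exists>i>0. 0 < fps_nth f6 i"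
    and e_pos: "\<exists>i. 0 < fps_nth e1 i" "\<exists>i. 0 < fps_nth e2 i" "\<exists>i. 0 < fps_nth e3 i"
begin

lemma swap23: "compatible_rows (\<lambda>x y z. r x z y) f2 f1 f5 f6 f3 f4 e1 e3 e2"
proof
  show "proportional_rows (\<lambda>x y z. r x z y) f2 f1 e1"
    by (rule proportional_rows_commute) (rule rows1)
  show "\<exists>y z. 0 < r x z y" for x using range1[of x] by blast
qed (rule r_nonneg rows2 rows3 range2 range3 f_nonneg e_nonneg f_pos e_pos)+

lemma swap12: "compatible_rows (\<lambda>x y z. r y x z) f3 f4 f1 f2 f6 f5 e2 e1 e3"
proof
  show "proportional_rows (\<lambda>z x y. r y x z) f6 f5 e3"
    using proportional_rows_commute[OF rows3] .
  show "\<exists>x y. 0 < r y x z" for z using range3[of z] by blast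
qed (rule r_nonneg rows1 rows2 range1 range2 f_nonneg e_nonneg f_pos e_pos)+

lemma row1:
  assumes "0 < r x' y z"
  obtains k where "0 < k" "\<And>x. r x y z = k * fps_nth (f1 ^ y * f2 ^ z * e1) x"
proof -
  from rows1 assms obtain k where k: "\<And>x. r x y z = k * fps_nth (f1 ^ y * f2 ^ z * e1) x"
    unfolding proportional_rows_def by blast
  have "0 \<le> fps_nth (f1 ^ y * f2 ^ z * e1) x'"
    by (intro fps_mult_nth_nonneg fps_power_nth_nonneg f_nonneg e_nonneg)
  with k[of x'] assms have "0 < k"
    by (simp add: zero_less_mult_iff)
  with k that show ?thesis by blast
qed

text \<open>The value 0 is attained by the first coordinate, and the constant term of a product is
  the product of the constant terms.\<close>

lemma e1_0: "0 < fps_nth e1 0"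
proof -
  obtain y z where 0: "0 < r 0 y z"
    using range1 by blast
  then obtain k where "r 0 y z = k * fps_nth (f1 ^ y * f2 ^ z * e1) 0"
    by (rule row1) blast
  with 0 have "fps_nth e1 0 \<noteq> 0" by auto
  with e_nonneg(1)[of 0] show ?thesis by simp
qed

text \<open>If \<open>f1\<close> had no constant term, then x \<open>\<ge>\<close> y on the support, whereas the row of y given
  (x, z) contains entries beyond x as soon as z > 0.\<close>

lemma f1_0: "0 < fps_nth f1 0"
proof (rule ccontr)
  interpret s12: compatible_rows "\<lambda>x y z. r y x z" f3 f4 f1 f2 f6 f5 e2 e1 e3
    by (rule swap12)
  assume "\<not> 0 < fps_nth f1 0"
  with f_nonneg(1)[of 0] have f1: "fps_nth f1 0 = 0" by simp
  have le: "y \<le> x" if xyz: "0 < r x y z" for x y z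
  proof (rule ccontr)
    assume "\<not> y \<le> x"
    moreover from xyz obtain k where "r x y z = k * fps_nth (f1 ^ y * f2 ^ z * e1) x"
      by (rule row1) blast
    ultimately show False
      using xyz fps_power_mult_nth_eq_0[OF f1, of x y "f2 ^ z * e1"] by (simp add: mult.assoc)
  qed
  \<comment> \<open>At \<open>z = 1\<close> the factor \<open>f4\<close> occurs once and contributes
    an exponent \<open>j > 0\<close>, while the \<open>x\<close> copies of \<open>f3\<close>
    contribute at least \<open>x\<close>.\<close>
  obtain x y where 1: "0 < r x y 1"
    using range3 by blast
  obtain i j l where ijl: "0 < i" "0 < fps_nth f3 i" "0 < j" "0 < fps_nth f4 j" "0 < fps_nth e2 l"
    using f_pos e_pos by blast
  from 1 obtain k where "0 < k" "\<And>y. r x y 1 = k * fps_nth (f3 ^ x * f4 ^ 1 * e2) y"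
    by (rule s12.row1) blast
  then have "0 < r x (x * i + 1 * j + l) 1"
    using fps_power_mult_nth_pos[OF f_nonneg(3,4) e_nonneg(2) ijl(2,4,5), of x 1] by simp
  then have "x * i + 1 * j + l \<le> x"
    by (rule le)
  moreover have "x \<le> x * i" using ijl by simp
  ultimately show False using ijl by simp
qed

text \<open>Since \<open>f1\<close> and \<open>f2\<close> have positive constant terms, the support
  of every nonzero row contains that of \<open>e1\<close>.\<close>

lemma row_pos:
  assumes "0 < r x' y z" "0 < fps_nth e1 x"
  shows "0 < r x y z"
proof -
  interpret s23: compatible_rows "\<lambda>x y z. r x z y" f2 f1 f5 f6 f3 f4 e1 e3 e2
    by (rule swap23)
  from assms(1) obtain k where "0 < k" "r x y z = k * fps_nth (f1 ^ y * f2 ^ z * e1) x"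
    by (rule row1) blast
  then show ?thesis
    using fps_power_mult_nth_pos[OF f_nonneg(1,2) e_nonneg(1) f1_0 s23.f1_0 assms(2), of y z] by simp
qed

text \<open>Some entry with first coordinate \<open>x\<close> is positive; \<open>row_pos\<close>
  moves its other coordinates to 0 one at a time, because \<open>e2\<close> and \<open>e3\<close>
  have positive constant terms.\<close>

lemma axis_pos: "0 < r x 0 0"
proof -
  interpret s12: compatible_rows "\<lambda>x y z. r y x z" f3 f4 f1 f2 f6 f5 e2 e1 e3
    by (rule swap12)
  interpret s13: compatible_rows "\<lambda>x y z. r z y x" f6 f5 f4 f3 f2 f1 e3 e2 e1
    by (rule compatible_rows.swap12[OF compatible_rows.swap23[OF swap12]])
  obtain y z where "0 < r x y z"
    using range1 by blast
  then have "0 < r x 0 z"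
    by (rule s12.row_pos) (rule s12.e1_0)
  then show ?thesis
    by (rule s13.row_pos) (rule s13.e1_0)
qed

text \<open>The row at \<open>y = z = 0\<close> is a multiple of \<open>e1\<close> itself and lies
  on the positive axis.\<close>

lemma e1_pos: "0 < fps_nth e1 x"
proof -
  obtain k where "0 < k" "\<And>x. r x 0 0 = k * fps_nth (f1 ^ 0 * f2 ^ 0 * e1) x"
    using axis_pos[of 0] by (rule row1) blast
  then show ?thesis
    using axis_pos[of x] by (simp add: zero_less_mult_iff)
qed

lemma r_pos: "0 < r x y z"
proof -
  interpret s12: compatible_rows "\<lambda>x y z. r y x z" f3 f4 f1 f2 f6 f5 e2 e1 e3
    by (rule swap12)
  interpret s13: compatible_rows "\<lambda>x y z. r z y x" f6 f5 f4 f3 f2 f1 e3 e2 e1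
    by (rule compatible_rows.swap12[OF compatible_rows.swap23[OF swap12]])
  have "0 < r x y 0"
    using axis_pos by (rule s12.row_pos) (rule s12.e1_pos)
  then show ?thesis
    by (rule s13.row_pos) (rule s13.e1_pos)
qed

lemma row1_normalized:
  "r x y z = r 0 y z * fps_nth ((fps_const (1 / fps_nth f1 0) * f1) ^ y
      * (fps_const (1 / fps_nth f2 0) * f2) ^ z * (fps_const (1 / fps_nth e1 0) * e1)) x"
proof -
  interpret s23: compatible_rows "\<lambda>x y z. r x z y" f2 f1 f5 f6 f3 f4 e1 e3 e2
    by (rule swap23)
  obtain k where k: "\<And>x. r x y z = k * fps_nth (f1 ^ y * f2 ^ z * e1) x"
    using r_pos[of 0 y z] by (rule row1) blast
  let ?c = "fps_nth f1 0" and ?d = "fps_nth f2 0" and ?e = "fps_nth e1 0"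
  have nz: "?c \<noteq> 0" "?d \<noteq> 0" "?e \<noteq> 0"
    using f1_0 s23.f1_0 e1_0 by simp_all
  let ?F = "(fps_const (1 / ?c) * f1) ^ y * (fps_const (1 / ?d) * f2) ^ z * (fps_const (1 / ?e) * e1)"
  \<comment> \<open>The exponent 1 lets \<open>fps_unscale_power\<close> treat \<open>e1\<close>
    like the other factors.\<close>
  have "f1 ^ y * f2 ^ z * e1 ^ 1 = fps_const (?c ^ y * ?d ^ z * ?e) * ?F"
    unfolding fps_unscale_power[OF nz(1), of f1 y] fps_unscale_power[OF nz(2), of f2 z]
      fps_unscale_power[OF nz(3), of e1 1]
    by (simp only: fps_const_mult[symmetric] power_one_right mult_ac)
  then have "r x y z = k * (?c ^ y * ?d ^ z * ?e * fps_nth ?F x)" for x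
    by (simp only: k power_one_right fps_mult_left_const_nth)
  \<comment> \<open>Evaluation at \<open>x = 0\<close> therefore identifies the remaining constant
    as \<open>r 0 y z\<close>.\<close>
  moreover have "fps_nth ?F 0 = 1"
    unfolding fps_nth_power_mult_0 using nz by simp
  ultimately show ?thesis by (simp only:)
qed

lemma normalized_rows:
  "normalized_rows r (fps_const (1 / fps_nth f1 0) * f1) (fps_const (1 / fps_nth f2 0) * f2)
     (fps_const (1 / fps_nth f3 0) * f3) (fps_const (1 / fps_nth f4 0) * f4)
     (fps_const (1 / fps_nth f5 0) * f5) (fps_const (1 / fps_nth f6 0) * f6)
     (fps_const (1 / fps_nth e1 0) * e1) (fps_const (1 / fps_nth e2 0) * e2)
     (fps_const (1 / fps_nth e3 0) * e3)"
proof -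
  \<comment> \<open>The five nontrivial permutations bring each of \<open>f2\<close>, ...,
    \<open>f6\<close> into first place, so that \<open>f1_0\<close> applies to all six
    series.\<close>
  interpret s23: compatible_rows "\<lambda>x y z. r x z y" f2 f1 f5 f6 f3 f4 e1 e3 e2
    by (rule swap23)
  interpret s12: compatible_rows "\<lambda>x y z. r y x z" f3 f4 f1 f2 f6 f5 e2 e1 e3
    by (rule swap12)
  interpret s123: compatible_rows "\<lambda>x y z. r z x y" f4 f3 f6 f5 f1 f2 e2 e3 e1
    by (rule s12.swap23)
  interpret s132: compatible_rows "\<lambda>x y z. r y z x" f5 f6 f2 f1 f4 f3 e3 e1 e2
    by (rule s23.swap12)
  interpret s13: compatible_rows "\<lambda>x y z. r z y x" f6 f5 f4 f3 f2 f1 e3 e2 e1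
    by (rule s123.swap12)
  note f_0 = f1_0 s23.f1_0 s12.f1_0 s123.f1_0 s132.f1_0 s13.f1_0
  note e_0 = e1_0 s12.e1_0 s13.e1_0
  note scaled_neq = scaled_neq_1[OF f_pos(1) f_0(1)] scaled_neq_1[OF f_pos(2) f_0(2)]
    scaled_neq_1[OF f_pos(3) f_0(3)] scaled_neq_1[OF f_pos(4) f_0(4)]
    scaled_neq_1[OF f_pos(5) f_0(5)] scaled_neq_1[OF f_pos(6) f_0(6)]
  show ?thesis
  proof
    show "0 < r x y z" for x y z by (rule r_pos)
  next
    fix x y z
    show "r x y z = r 0 y z * fps_nth ((fps_const (1 / fps_nth f1 0) * f1) ^ y
      * (fps_const (1 / fps_nth f2 0) * f2) ^ z * (fps_const (1 / fps_nth e1 0) * e1)) x"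
      by (rule row1_normalized)
    show "r x y z = r x 0 z * fps_nth ((fps_const (1 / fps_nth f3 0) * f3) ^ x
      * (fps_const (1 / fps_nth f4 0) * f4) ^ z * (fps_const (1 / fps_nth e2 0) * e2)) y"
      by (rule s12.row1_normalized)
    show "r x y z = r x y 0 * fps_nth ((fps_const (1 / fps_nth f5 0) * f5) ^ x
      * (fps_const (1 / fps_nth f6 0) * f6) ^ y * (fps_const (1 / fps_nth e3 0) * e3)) z"
      by (rule s132.row1_normalized)
  qed ((rule scaled_neq | use f_0 e_0 in simp)+)
qed

end

section \<open>The Poisson-gamma mixture\<close>

lemma nn_integral_gamma_kernel:
  assumes c: "0 < c" and s: "0 < s"
  shows "(\<integral>\<^sup>+u. ennreal (indicator {0<..} u * (u powr (c - 1) * exp (- s * u))) \<partial>lborel)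
    = ennreal (Gamma c / s powr c)" (is "?I = _")
proof -
  have "ennreal (Gamma c)
      = (\<integral>\<^sup>+t. ennreal (indicator {0..} t * t powr (c - 1) / exp t) \<partial>lborel)"
    by (rule Gamma_conv_nn_integral_real[OF c])
  also have "\<dots> = ennreal s * (\<integral>\<^sup>+u. ennreal (indicator {0..} (0 + s * u)
      * (0 + s * u) powr (c - 1) / exp (0 + s * u)) \<partial>lborel)"
    using s by (subst nn_integral_real_affine[where t = 0 and c = s]) auto
  \<comment> \<open>The closed and the open half-line may be exchanged pointwise because
    \<open>0 powr (c - 1)\<close> is 0.\<close>
  also have "(\<lambda>u. ennreal (indicator {0..} (0 + s * u)
      * (0 + s * u) powr (c - 1) / exp (0 + s * u)))
      = (\<lambda>u. ennreal (s powr (c - 1))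
          * ennreal (indicator {0<..} u * (u powr (c - 1) * exp (- s * u))))"
    using s by (auto simp: fun_eq_iff indicator_def zero_le_mult_iff powr_mult exp_minus
        divide_inverse ennreal_mult'[symmetric] mult.assoc)
  also have "ennreal s * (\<integral>\<^sup>+u. ennreal (s powr (c - 1))
          * ennreal (indicator {0<..} u * (u powr (c - 1) * exp (- s * u))) \<partial>lborel)
      = ennreal (s * s powr (c - 1)) * ?I"
    using s by (subst nn_integral_cmult) (auto simp: ennreal_mult mult.assoc)
  also have "s * s powr (c - 1) = s powr c"
    using s by (simp add: powr_diff)
  finally have "ennreal (1 / s powr c) * ennreal (Gamma c)
      = ennreal (1 / s powr c * s powr c) * ?I"
    using s by (simp only: ennreal_mult'' mult.assoc powr_ge_zero)
  moreover have "ennreal (1 / s powr c) * ennreal (Gamma c) = ennreal (Gamma c / s powr c)"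
    using s c by (simp add: ennreal_mult'[symmetric])
  ultimately show ?thesis using s by simp
qed

text \<open>The integrand multiplied by the gamma density is again a gamma kernel, with shape
  \<open>a + c\<close> and rate \<open>b + t\<close>. The form of \<open>f\<close> is prescribed
  only for positive arguments, where the measure lives.\<close>

lemma nn_integral_gamma_distribution:
  assumes a: "0 < a" and b: "0 < b" and c: "0 < a + c" and t: "0 < b + t" and k: "0 \<le> k"
    and f: "\<And>u. 0 < u \<Longrightarrow> f u = ennreal (k * (u powr c * exp (- t * u)))"
  shows "(\<integral>\<^sup>+u. f u \<partial>gamma_distribution a b)
    = ennreal (b powr a / Gamma a * k * (Gamma (a + c) / (b + t) powr (a + c)))"
proof -
  let ?g = "\<lambda>u. ennreal (b powr a / Gamma a * u powr (a - 1) * exp (- b * u))"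
  let ?R = "restrict_space lborel {0<..} :: real measure"
  have "f \<in> borel_measurable ?R \<longleftrightarrow> (\<lambda>u. ennreal (k * (u powr c * exp (- t * u)))) \<in> borel_measurable ?R"
    by (rule measurable_cong) (simp add: f space_restrict_space)
  then have mf: "f \<in> borel_measurable ?R"
    by (simp add: measurable_restrict_space1)
  have mg: "?g \<in> borel_measurable ?R"
    by (intro measurable_restrict_space1) measurable
  have "(\<integral>\<^sup>+u. f u \<partial>gamma_distribution a b) = (\<integral>\<^sup>+u. ?g u * f u * indicator {0<..} u \<partial>lborel)"
    unfolding gamma_distribution_def
    by (subst nn_integral_density[OF mg mf], subst nn_integral_restrict_space) simp_all
  also have "\<dots> = (\<integral>\<^sup>+u. ennreal (b powr a / Gamma a * k)
      * ennreal (indicator {0<..} u * (u powr (a + c - 1) * exp (- (b + t) * u))) \<partial>lborel)"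
  proof (rule nn_integral_cong)
    fix u :: real
    show "?g u * f u * indicator {0<..} u = ennreal (b powr a / Gamma a * k)
      * ennreal (indicator {0<..} u * (u powr (a + c - 1) * exp (- (b + t) * u)))"
    proof (cases "0 < u")
      case True
      have "u powr (a - 1) * u powr c = u powr (a + c - 1)"
        by (simp add: algebra_simps flip: powr_add)
      moreover have "exp (- b * u) * exp (- t * u) = exp (- (b + t) * u)"
        by (simp add: algebra_simps flip: exp_add)
      moreover have "b powr a / Gamma a * u powr (a - 1) * exp (- b * u) * (k * (u powr c * exp (- t * u)))
          = b powr a / Gamma a * k * ((u powr (a - 1) * u powr c) * (exp (- b * u) * exp (- t * u)))"
        by (simp only: mult_ac)
      ultimately have "b powr a / Gamma a * u powr (a - 1) * exp (- b * u) * (k * (u powr c * exp (- t * u)))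
          = b powr a / Gamma a * k * (u powr (a + c - 1) * exp (- (b + t) * u))"
        by (simp only:)
      moreover have "0 \<le> b powr a / Gamma a" using a by simp
      ultimately show ?thesis
        using True k by (simp only: f ennreal_mult[symmetric] indicator_simps mult_1 mult_1_right
            mult_nonneg_nonneg powr_ge_zero exp_ge_zero greaterThan_iff)
    qed simp
  qed
  also have "\<dots> = ennreal (b powr a / Gamma a * k) * ennreal (Gamma (a + c) / (b + t) powr (a + c))"
    by (subst nn_integral_cmult) (use nn_integral_gamma_kernel[OF c t] in simp_all)
  also have "\<dots> = ennreal (b powr a / Gamma a * k * (Gamma (a + c) / (b + t) powr (a + c)))"
    using a c k by (intro ennreal_mult[symmetric]) simp_all
  finally show ?thesis .
qed

lemma prob_space_gamma_distribution:
  assumes "0 < a" "0 < b"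
  shows "prob_space (gamma_distribution a b)"
proof
  have \<Gamma>: "Gamma a \<noteq> 0" using Gamma_real_pos[OF assms(1)] by linarith
  have "emeasure (gamma_distribution a b) (space (gamma_distribution a b))
      = (\<integral>\<^sup>+u. 1 \<partial>gamma_distribution a b)"
    by simp
  also have "\<dots> = ennreal (b powr a / Gamma a * 1 * (Gamma (a + 0) / (b + 0) powr (a + 0)))"
    using assms by (intro nn_integral_gamma_distribution) auto
  also have "\<dots> = 1"
    using assms \<Gamma> by simp
  finally show "emeasure (gamma_distribution a b) (space (gamma_distribution a b)) = 1" .
qed

lemma space_gamma_distribution [simp]: "space (gamma_distribution a b) = {0<..}"
  by (simp add: gamma_distribution_def space_restrict_space)

section \<open>The Poisson kernel and its gamma mixture\<close>

lemma pmf_poisson_triple: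
  assumes "0 < l1" "0 < l2" "0 < l3" "0 < u"
  shows "pmf (pair_pmf (poisson_pmf (l1 * u)) (pair_pmf (poisson_pmf (l2 * u)) (poisson_pmf (l3 * u))))
      (x, y, z) = l1 ^ x * l2 ^ y * l3 ^ z / (fact x * fact y * fact z)
        * (u powr (real (x + y + z)) * exp (- (l1 + l2 + l3) * u))"
proof -
  have e: "exp (- (l1 + l2 + l3) * u) = exp (- (l1 * u)) * (exp (- (l2 * u)) * exp (- (l3 * u)))"
    by (simp add: algebra_simps flip: exp_add)
  have p: "u powr (real (x + y + z)) = u ^ x * (u ^ y * u ^ z)"
    using assms by (simp add: powr_realpow power_add mult.assoc flip: of_nat_add)
  show ?thesis
    unfolding e p using assms by (simp add: pmf_pair power_mult_distrib mult_ac)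
qed

text \<open>The mass of a set is a countable sum of point masses, each an explicit measurable
  function of \<open>u\<close>. The sum is treated as an integral over a counting measure, so that
  measurability of parametrized integrals applies.\<close>

lemma measurable_poisson_kernel:
  assumes "0 < l1" "0 < l2" "0 < l3"
  shows "(\<lambda>u. measure_pmf (pair_pmf (poisson_pmf (l1 * u))
       (pair_pmf (poisson_pmf (l2 * u)) (poisson_pmf (l3 * u)))))
     \<in> gamma_distribution a b \<rightarrow>\<^sub>M subprob_algebra (count_space UNIV)"
proof (rule measurable_subprob_algebra)
  fix A :: "(nat \<times> nat \<times> nat) set"
  let ?K = "\<lambda>u. pair_pmf (poisson_pmf (l1 * u)) (pair_pmf (poisson_pmf (l2 * u)) (poisson_pmf (l3 * u)))"
  let ?G = "gamma_distribution a b"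
  interpret sigma_finite_measure "count_space A"
    by (rule sigma_finite_measure_count_space_countable) simp
  have "(\<lambda>u. pmf (?K u) w) \<in> borel_measurable ?G" for w
  proof -
    obtain x y z where w: "w = (x, y, z)" by (cases w) auto
    let ?f = "\<lambda>u. l1 ^ x * l2 ^ y * l3 ^ z / (fact x * fact y * fact z)
        * (u powr (real (x + y + z)) * exp (- (l1 + l2 + l3) * u))"
    have "?f \<in> borel_measurable ?G"
      unfolding gamma_distribution_def by (simp add: measurable_restrict_space1)
    then show ?thesis
      unfolding w by (subst measurable_cong) (use pmf_poisson_triple[OF assms] in simp_all)
  qed
  then have "(\<lambda>(w, u). ennreal (pmf (?K u) w)) \<in> borel_measurable (count_space A \<Otimes>\<^sub>M ?G)"
    by (intro measurable_pair_measure_countable1) simp_all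
  then have "(\<lambda>(u, w). ennreal (pmf (?K u) w)) \<in> borel_measurable (?G \<Otimes>\<^sub>M count_space A)"
    by (subst measurable_pair_swap_iff) (simp only: prod.case)
  then have "(\<lambda>u. \<integral>\<^sup>+w. ennreal (pmf (?K u) w) \<partial>count_space A) \<in> borel_measurable ?G"
    by (rule borel_measurable_nn_integral)
  then show "(\<lambda>u. emeasure (measure_pmf (?K u)) A) \<in> borel_measurable ?G"
    by (simp only: nn_integral_pmf)
qed (rule measure_pmf.subprob_space_axioms, simp)

lemma prob_space_poisson_gamma:
  assumes "0 < a" "0 < b" "0 < l1" "0 < l2" "0 < l3"
  shows "prob_space (poisson_gamma a b l1 l2 l3)"
  unfolding poisson_gamma_def
  by (rule prob_space.prob_space_bind[OF prob_space_gamma_distribution[OF assms(1,2)] _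
        measurable_poisson_kernel[OF assms(3-5)]]) (simp add: measure_pmf.prob_space_axioms)

lemma sets_poisson_gamma:
  assumes "0 < l1" "0 < l2" "0 < l3"
  shows "sets (poisson_gamma a b l1 l2 l3) = UNIV"
  unfolding poisson_gamma_def using measurable_poisson_kernel[OF assms]
  by (subst sets_bind[where N = "count_space UNIV"]) simp_all

text \<open>Integrating the Poisson probabilities gives the gamma kernel with shape
  \<open>a + n\<close> and rate \<open>s\<close>. The quotient
  \<open>Gamma (a + n) / Gamma a\<close> is the rising factorial, and the powers of \<open>s\<close>
  are shared out among the rates.\<close>

lemma emeasure_poisson_gamma_singleton:
  assumes "0 < a" "0 < b" "0 < l1" "0 < l2" "0 < l3"
  defines "s \<equiv> b + (l1 + l2 + l3)"
  shows "emeasure (poisson_gamma a b l1 l2 l3) {(x, y, z)}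
    = ennreal ((b / s) powr a * negmult_coeff a (l1 / s) (l2 / s) (l3 / s) x y z)"
proof -
  define n where "n = x + y + z"
  have s: "0 < s" using assms by simp
  have \<Gamma>: "Gamma a \<noteq> 0" using Gamma_real_pos[OF assms(1)] by linarith
  have "emeasure (poisson_gamma a b l1 l2 l3) {(x, y, z)}
      = (\<integral>\<^sup>+u. emeasure (measure_pmf (pair_pmf (poisson_pmf (l1 * u))
       (pair_pmf (poisson_pmf (l2 * u)) (poisson_pmf (l3 * u))))) {(x, y, z)} \<partial>gamma_distribution a b)"
    unfolding poisson_gamma_def
    by (rule emeasure_bind[OF _ measurable_poisson_kernel]) (use assms in auto)
  also have "\<dots> = ennreal (b powr a / Gamma a * (l1 ^ x * l2 ^ y * l3 ^ z / (fact x * fact y * fact z))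
      * (Gamma (a + real n) / (b + (l1 + l2 + l3)) powr (a + real n)))"
    by (rule nn_integral_gamma_distribution)
       (use assms pmf_poisson_triple in \<open>simp_all add: emeasure_pmf_single n_def\<close>)
  also have "Gamma (a + real n) = Gamma a * pochhammer a n"
    using assms(1) \<Gamma> by (subst pochhammer_Gamma) (auto elim!: nonpos_Ints_cases)
  also have "(b + (l1 + l2 + l3)) powr (a + real n) = s powr a * (s ^ x * s ^ y * s ^ z)"
    using s by (simp add: s_def powr_add powr_realpow power_add n_def)
  also have "b powr a / Gamma a * (l1 ^ x * l2 ^ y * l3 ^ z / (fact x * fact y * fact z))
      * (Gamma a * pochhammer a n / (s powr a * (s ^ x * s ^ y * s ^ z)))
      = (b / s) powr a * negmult_coeff a (l1 / s) (l2 / s) (l3 / s) x y z"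
    using assms s \<Gamma>
    by (simp add: negmult_coeff_def n_def powr_divide power_divide field_simps)
  finally show ?thesis .
qed

text \<open>Total mass 1 forces the parameters to sum to less than 1: otherwise the bound
  \<open>le\<close> would make \<open>C\<close> arbitrarily small. The Poisson-gamma law then has
  proportional point masses, and normalization makes them equal.\<close>

lemma negative_multinomial_pmf:
  assumes a: "0 < a" and \<rho>: "0 < \<rho>1" "0 < \<rho>2" "0 < \<rho>3"
    and p: "\<And>x y z. pmf p (x, y, z) = C * negmult_coeff a \<rho>1 \<rho>2 \<rho>3 x y z"
  shows "\<rho>1 + \<rho>2 + \<rho>3 < 1"
    and "measure_pmf p = poisson_gamma a (1 - (\<rho>1 + \<rho>2 + \<rho>3)) \<rho>1 \<rho>2 \<rho>3"
proof -
  define s where "s = \<rho>1 + \<rho>2 + \<rho>3"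
  have s: "0 < s" using \<rho> by (simp add: s_def)
  have C: "0 < C"
  proof -
    obtain x y z where "(x, y, z) \<in> set_pmf p"
      by (metis ex_in_conv prod_cases3 set_pmf_not_empty)
    then have "0 < C * negmult_coeff a \<rho>1 \<rho>2 \<rho>3 x y z"
      by (simp add: p flip: pmf_positive_iff)
    then show ?thesis
      using negmult_coeff_pos[OF a \<rho>] by (rule zero_less_mult_pos2)
  qed
  have total: "(\<integral>\<^sup>+w. emeasure (poisson_gamma a b l1 l2 l3) {w} \<partial>count_space UNIV) = 1"
    if "0 < b" "0 < l1" "0 < l2" "0 < l3" for b l1 l2 l3
  proof -
    have "space (poisson_gamma a b l1 l2 l3) = UNIV"
      using sets_poisson_gamma[OF that(2-4)] sets_eq_imp_space_eq[of "poisson_gamma a b l1 l2 l3" "count_space UNIV"]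
      by simp
    then show ?thesis
      using prob_space.emeasure_space_1[OF prob_space_poisson_gamma[OF a that]]
        emeasure_countable_singleton[of UNIV "poisson_gamma a b l1 l2 l3"] sets_poisson_gamma[OF that(2-4)]
      by simp
  qed
  \<comment> \<open>Scaling every rate by \<open>\<theta>\<close> gives a Poisson-gamma law, of total mass 1, dominated by a multiple of p.\<close>
  have le: "C \<le> (1 - \<theta> * s) powr a" if \<theta>: "0 < \<theta>" "\<theta> \<le> 1" "\<theta> * s < 1" for \<theta>
  proof -
    let ?P = "poisson_gamma a (1 - \<theta> * s) (\<theta> * \<rho>1) (\<theta> * \<rho>2) (\<theta> * \<rho>3)"
    let ?c = "(1 - \<theta> * s) powr a / C"
    \<comment> \<open>The rate \<open>1 - \<theta> * s\<close> makes the total rate 1, so the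
      negative multinomial parameters are the Poisson rates themselves.\<close>
    have sum1: "1 - \<theta> * s + (\<theta> * \<rho>1 + \<theta> * \<rho>2 + \<theta> * \<rho>3) = 1"
      by (simp add: s_def algebra_simps)
    have "emeasure ?P {w} \<le> ennreal ?c * ennreal (pmf p w)" for w
    proof -
      obtain x y z where w: "w = (x, y, z)" by (cases w) auto
      have "negmult_coeff a (\<theta> * \<rho>1) (\<theta> * \<rho>2) (\<theta> * \<rho>3) x y z
          = \<theta> ^ (x + y + z) * negmult_coeff a \<rho>1 \<rho>2 \<rho>3 x y z"
        by (simp add: negmult_coeff_def power_mult_distrib power_add mult_ac)
      also have "\<dots> \<le> 1 * negmult_coeff a \<rho>1 \<rho>2 \<rho>3 x y z"
        using \<theta> negmult_coeff_pos[OF a \<rho>, of x y z]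
        by (intro mult_right_mono power_le_one) auto
      finally have "(1 - \<theta> * s) powr a * negmult_coeff a (\<theta> * \<rho>1) (\<theta> * \<rho>2) (\<theta> * \<rho>3) x y z
          \<le> ?c * pmf p w"
        using C by (simp add: w p mult_left_mono)
      then show ?thesis
        using emeasure_poisson_gamma_singleton[OF a, of "1 - \<theta> * s" "\<theta> * \<rho>1" "\<theta> * \<rho>2" "\<theta> * \<rho>3" x y z]
          \<theta> \<rho> C unfolding sum1 w
        by (simp add: ennreal_leI flip: ennreal_mult'')
    qed
    then have "(\<integral>\<^sup>+w. emeasure ?P {w} \<partial>count_space UNIV)
        \<le> (\<integral>\<^sup>+w. ennreal ?c * ennreal (pmf p w) \<partial>count_space UNIV)"
      by (intro nn_integral_mono) auto
    also have "\<dots> = ennreal ?c"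
      by (simp add: nn_integral_cmult nn_integral_pmf)
    finally have "1 \<le> ?c"
      using \<theta> \<rho> by (simp add: total)
    then show ?thesis using C by simp
  qed
  have s1: "s < 1"
  proof (rule ccontr)
    assume "\<not> s < 1"
    \<comment> \<open>With \<open>\<theta> = (1 - \<epsilon>) / s\<close> the bound becomes
      \<open>C \<le> \<epsilon> powr a\<close>, and this choice of \<open>\<epsilon>\<close> makes
      the right side at most \<open>C / 2\<close>.\<close>
    define \<epsilon> where "\<epsilon> = min (1 / 2) ((C / 2) powr (1 / a))"
    have \<epsilon>: "0 < \<epsilon>" "\<epsilon> < 1" using C by (auto simp: \<epsilon>_def)
    have "C \<le> (1 - (1 - \<epsilon>) / s * s) powr a"
      using \<epsilon> s \<open>\<not> s < 1\<close> by (intro le) auto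
    also have "\<dots> = \<epsilon> powr a"
      using s by simp
    also have "\<dots> \<le> ((C / 2) powr (1 / a)) powr a"
      using \<epsilon> a by (intro powr_mono2) (auto simp: \<epsilon>_def)
    also have "\<dots> = C / 2"
      using a C by (simp add: powr_powr)
    finally show False using C by simp
  qed
  then show "\<rho>1 + \<rho>2 + \<rho>3 < 1" by (simp add: s_def)
  let ?P = "poisson_gamma a (1 - s) \<rho>1 \<rho>2 \<rho>3" and ?c = "(1 - s) powr a / C"
  have P: "emeasure ?P {w} = ennreal ?c * ennreal (pmf p w)" for w
  proof -
    obtain x y z where w: "w = (x, y, z)" by (cases w) auto
    have "emeasure ?P {w} = ennreal ((1 - s) powr a * negmult_coeff a \<rho>1 \<rho>2 \<rho>3 x y z)"
      using emeasure_poisson_gamma_singleton[OF a, of "1 - s" \<rho>1 \<rho>2 \<rho>3 x y z] s1 \<rho>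
      by (simp add: w s_def)
    also have "(1 - s) powr a * negmult_coeff a \<rho>1 \<rho>2 \<rho>3 x y z = ?c * pmf p w"
      using C by (simp add: w p)
    finally show ?thesis by (simp only: ennreal_mult'' pmf_nonneg)
  qed
  have "1 = (\<integral>\<^sup>+w. ennreal ?c * ennreal (pmf p w) \<partial>count_space UNIV)"
    using total[of "1 - s" \<rho>1 \<rho>2 \<rho>3] s1 \<rho> by (simp add: P)
  also have "\<dots> = ennreal ?c"
    by (simp add: nn_integral_cmult nn_integral_pmf)
  finally have c: "ennreal ?c = 1" ..
  have "emeasure ?P {w} = ennreal (pmf p w)" for w
    unfolding P c by simp
  then show "measure_pmf p = poisson_gamma a (1 - (\<rho>1 + \<rho>2 + \<rho>3)) \<rho>1 \<rho>2 \<rho>3"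
    unfolding s_def[symmetric]
    by (intro measure_eqI_countable[where A = UNIV])
       (simp_all add: sets_poisson_gamma \<rho> emeasure_pmf_single)
qed

section \<open>The characterization\<close>

lemma pmf_fps_geometric:
  assumes "0 < \<rho>" "\<rho> < 1"
  shows "pmf_fps (geometric_pmf (1 - \<rho>)) = fps_const (1 - \<rho>) * negbin_fps 1 \<rho>"
proof (rule fps_ext)
  fix n
  show "fps_nth (pmf_fps (geometric_pmf (1 - \<rho>))) n = fps_nth (fps_const (1 - \<rho>) * negbin_fps 1 \<rho>) n"
    using assms by (simp flip: pochhammer_fact)
qed

lemma nonconstant_geometric:
  assumes "0 < p" "p < 1"
  shows "nonconstant (geometric_pmf p)"
proof -
  have "set_pmf (geometric_pmf p) \<noteq> {c}" for c
    using set_pmf_geometric[OF assms] infinite_UNIV_nat by (metis finite.emptyI finite.insertI)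
  then show ?thesis
    unfolding nonconstant_def by (metis set_return_pmf)
qed

text \<open>Each geometric summand adds 1 to the exponent of the series of \<open>eps\<close>,
  giving \<open>a + (y + z)\<close>. The scalar factors are absorbed into the constant of the
  row.\<close>

lemma proportional_rows_negbin:
  assumes \<rho>: "0 < \<rho>" "\<rho> < 1"
    and r: "\<And>x y z. r x y z = g y z * fps_nth (negbin_fps (a + real (y + z)) \<rho>) x"
    and eps: "\<And>x. pmf eps x = d * fps_nth (negbin_fps a \<rho>) x" "d \<noteq> 0"
  shows "proportional_rows r (pmf_fps (geometric_pmf (1 - \<rho>))) (pmf_fps (geometric_pmf (1 - \<rho>)))
    (pmf_fps eps)"
  unfolding proportional_rows_def
proof (intro allI impI)
  fix y z
  let ?G = "pmf_fps (geometric_pmf (1 - \<rho>))"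
  have e: "pmf_fps eps = fps_const d * negbin_fps a \<rho>"
    by (rule fps_ext) (simp only: pmf_fps_nth eps(1) fps_mult_left_const_nth)
  have "?G ^ y * ?G ^ z * pmf_fps eps
      = fps_const ((1 - \<rho>) ^ (y + z) * d) * (negbin_fps 1 \<rho> ^ (y + z) * negbin_fps a \<rho>)"
    unfolding pmf_fps_geometric[OF \<rho>] e power_mult_distrib fps_const_power
    by (simp only: power_add fps_const_mult[symmetric] mult_ac)
  also have "negbin_fps 1 \<rho> ^ (y + z) * negbin_fps a \<rho> = negbin_fps (a + real (y + z)) \<rho>"
    by (simp only: negbin_fps_power negbin_fps_add mult_1_left mult_1_right mult.commute)
  finally have G: "fps_nth (?G ^ y * ?G ^ z * pmf_fps eps) x
      = (1 - \<rho>) ^ (y + z) * d * fps_nth (negbin_fps (a + real (y + z)) \<rho>) x" for x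
    by (simp only: fps_mult_left_const_nth)
  have nz: "(1 - \<rho>) ^ (y + z) * d \<noteq> 0"
    using \<rho> eps by simp
  have cancel: "g y z / c * (c * t) = g y z * t" if "c \<noteq> 0" for c t
    using that by simp
  show "\<exists>k. \<forall>x. r x y z = k * fps_nth (?G ^ y * ?G ^ z * pmf_fps eps) x"
    by (rule exI[of _ "g y z / ((1 - \<rho>) ^ (y + z) * d)"]) (simp only: G r cancel[OF nz] simp_thms)
qed

text \<open>The law of the noise term is taken to be the conditional law of \<open>A\<close> at
  \<open>B = C = 0\<close>, where there are no summands. It is thus a pmf from the start, and its
  negative binomial form is read off from \<open>p\<close>.\<close>

lemma conditionally_compound_negbin:
  assumes h: "\<And>s. h (A s) (B s) (C s) = s"
    and ABC: "\<And>a b c. A (h a b c) = a" "\<And>a b c. B (h a b c) = b" "\<And>a b c. C (h a b c) = c"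
    and a: "0 < a" and \<rho>: "0 < \<rho>" "0 < \<rho>'" "0 < \<rho>''" "\<rho> < 1" and D: "0 < D"
    and p: "\<And>x y z. pmf p (h x y z) = D * negmult_coeff a \<rho> \<rho>' \<rho>'' x y z"
  shows "\<exists>eps. conditionally_compound p A B C (geometric_pmf (1 - \<rho>)) (geometric_pmf (1 - \<rho>)) eps"
proof
  let ?S = "{s. B s = 0 \<and> C s = 0}" and ?eps = "map_pmf A (cond_pmf p {s. B s = 0 \<and> C s = 0})"
  have pos: "0 < pmf p (h 0 0 0)"
    using negmult_coeff_pos[OF a \<rho>(1-3)] D by (simp add: p)
  note eps = pmf_map_cond_pmf_coordinates[where h = h and A = A and B = B and C = C, OF h ABC pos]
  have "proportional_rows (\<lambda>x y z. pmf p (h x y z)) (pmf_fps (geometric_pmf (1 - \<rho>)))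
      (pmf_fps (geometric_pmf (1 - \<rho>))) (pmf_fps ?eps)"
  proof (rule proportional_rows_negbin[OF \<rho>(1,4)])
    show "pmf p (h x y z) = D * negmult_coeff a \<rho> \<rho>' \<rho>'' 0 y z
        * fps_nth (negbin_fps (a + real (y + z)) \<rho>) x" for x y z
      unfolding p by (subst negmult_coeff_row) (rule mult.assoc[symmetric])
    show "pmf ?eps x = D / measure p ?S * fps_nth (negbin_fps a \<rho>) x" for x
      unfolding eps(1) p by (simp add: negmult_coeff_def)
    show "D / measure p ?S \<noteq> 0"
      using D eps(2) by simp
  qed
  then show "conditionally_compound p A B C (geometric_pmf (1 - \<rho>)) (geometric_pmf (1 - \<rho>)) ?eps"
    by (subst conditionally_compound_iff_proportional_rows[where h = h, OF h ABC])
qed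

lemmas coordinate_defs = X_of_def Y_of_def Z_of_def

lemma conditionally_compound_X:
  "conditionally_compound p X_of Y_of Z_of W V eps \<longleftrightarrow>
    proportional_rows (\<lambda>x y z. pmf p (x, y, z)) (pmf_fps W) (pmf_fps V) (pmf_fps eps)"
  by (rule conditionally_compound_iff_proportional_rows) (auto simp: coordinate_defs)

lemma conditionally_compound_Y:
  "conditionally_compound p Y_of X_of Z_of W V eps \<longleftrightarrow>
    proportional_rows (\<lambda>y x z. pmf p (x, y, z)) (pmf_fps W) (pmf_fps V) (pmf_fps eps)"
  by (rule conditionally_compound_iff_proportional_rows) (auto simp: coordinate_defs)

lemma conditionally_compound_Z:
  "conditionally_compound p Z_of X_of Y_of W V eps \<longleftrightarrow>
    proportional_rows (\<lambda>z x y. pmf p (x, y, z)) (pmf_fps W) (pmf_fps V) (pmf_fps eps)"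
  by (rule conditionally_compound_iff_proportional_rows) (auto simp: coordinate_defs)

lemma count_variables_iff:
  "count_variables p \<longleftrightarrow> (\<forall>x. \<exists>y z. 0 < pmf p (x, y, z)) \<and> (\<forall>y. \<exists>x z. 0 < pmf p (x, y, z)) \<and>
     (\<forall>z. \<exists>x y. 0 < pmf p (x, y, z))"
proof -
  have "f ` set_pmf p = UNIV \<longleftrightarrow> (\<forall>n. \<exists>x y z. (x, y, z) \<in> set_pmf p \<and> f (x, y, z) = n)"
    for f :: "nat \<times> nat \<times> nat \<Rightarrow> nat"
    by (simp add: set_eq_iff image_iff Bex_def split_paired_Ex eq_commute)
  then show ?thesis
    unfolding count_variables_def set_map_pmf pmf_positive_iff by (simp add: coordinate_defs)
qed

theorem theorem3:
  fixes p :: "(nat \<times> nat \<times> nat) pmf"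
  shows "(count_variables p \<and>
          (\<exists>W1 W2 W3 W4 W5 W6 eps1 eps2 eps3.
             nonconstant W1 \<and> nonconstant W2 \<and> nonconstant W3 \<and>
             nonconstant W4 \<and> nonconstant W5 \<and> nonconstant W6 \<and>
             solves_model p W1 W2 W3 W4 W5 W6 eps1 eps2 eps3))
     \<longleftrightarrow> (\<exists>a b l1 l2 l3. a > 0 \<and> b > 0 \<and> l1 > 0 \<and> l2 > 0 \<and> l3 > 0 \<and>
            measure_pmf p = poisson_gamma a b l1 l2 l3)"
proof (intro iffI)
  assume "count_variables p \<and> (\<exists>W1 W2 W3 W4 W5 W6 eps1 eps2 eps3.
             nonconstant W1 \<and> nonconstant W2 \<and> nonconstant W3 \<and>
             nonconstant W4 \<and> nonconstant W5 \<and> nonconstant W6 \<and>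
             solves_model p W1 W2 W3 W4 W5 W6 eps1 eps2 eps3)"
  then obtain W1 W2 W3 W4 W5 W6 eps1 eps2 eps3 where count: "count_variables p"
    and nc: "nonconstant W1" "nonconstant W2" "nonconstant W3"
      "nonconstant W4" "nonconstant W5" "nonconstant W6"
    and model: "solves_model p W1 W2 W3 W4 W5 W6 eps1 eps2 eps3"
    by blast
  have f: "\<exists>i>0. 0 < fps_nth (pmf_fps W) i" if "nonconstant W" for W
    using pmf_fps_pos_coeff[OF that] by blast
  have e: "\<exists>i. 0 < fps_nth (pmf_fps W) i" for W
    using pmf_fps_nonzero[of W] by blast
  interpret compatible_rows "\<lambda>x y z. pmf p (x, y, z)" "pmf_fps W1" "pmf_fps W2" "pmf_fps W3"
    "pmf_fps W4" "pmf_fps W5" "pmf_fps W6" "pmf_fps eps1" "pmf_fps eps2" "pmf_fps eps3"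
    by unfold_locales (use model count f[OF nc(1)] f[OF nc(2)] f[OF nc(3)] f[OF nc(4)]
        f[OF nc(5)] f[OF nc(6)] e in
        \<open>simp_all only: solves_model_def conditionally_compound_X conditionally_compound_Y
          conditionally_compound_Z count_variables_iff pmf_fps_nth pmf_nonneg\<close>)
  obtain a \<rho>1 \<rho>2 \<rho>3 where *: "0 < a" "0 < \<rho>1" "0 < \<rho>2" "0 < \<rho>3"
    "\<And>x y z. pmf p (x, y, z) = pmf p (0, 0, 0) * negmult_coeff a \<rho>1 \<rho>2 \<rho>3 x y z"
    by (rule normalized_rows.negative_multinomial[OF normalized_rows]) blast
  from negative_multinomial_pmf[OF *]
  show "\<exists>a b l1 l2 l3. a > 0 \<and> b > 0 \<and> l1 > 0 \<and> l2 > 0 \<and> l3 > 0 \<and>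
      measure_pmf p = poisson_gamma a b l1 l2 l3"
    \<comment> \<open>Rescaling the gamma variable leaves the mixture unchanged; the witness for
      \<open>b\<close> fixes the scale by total rate 1.\<close>
    using *(1-4) by (intro exI[of _ a] exI[of _ "1 - (\<rho>1 + \<rho>2 + \<rho>3)"] exI[of _ \<rho>1] exI[of _ \<rho>2]
        exI[of _ \<rho>3]) simp
next
  assume "\<exists>a b l1 l2 l3. a > 0 \<and> b > 0 \<and> l1 > 0 \<and> l2 > 0 \<and> l3 > 0 \<and>
      measure_pmf p = poisson_gamma a b l1 l2 l3"
  then obtain a b l1 l2 l3 where pos: "0 < a" "0 < b" "0 < l1" "0 < l2" "0 < l3"
    and eq: "measure_pmf p = poisson_gamma a b l1 l2 l3"
    by blast
  define s where "s = b + (l1 + l2 + l3)"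
  define \<rho>1 \<rho>2 \<rho>3 D where "\<rho>1 = l1 / s" "\<rho>2 = l2 / s" "\<rho>3 = l3 / s" "D = (b / s) powr a"
  note defs = \<rho>1_\<rho>2_\<rho>3_D_def
  have s: "0 < s" using pos by (simp add: s_def)
  have \<rho>: "0 < \<rho>1" "0 < \<rho>2" "0 < \<rho>3" "\<rho>1 < 1" "\<rho>2 < 1" "\<rho>3 < 1" and D: "0 < D"
    using pos s by (simp_all add: defs) (simp_all add: s_def)
  have p: "pmf p (x, y, z) = D * negmult_coeff a \<rho>1 \<rho>2 \<rho>3 x y z" for x y z
  proof -
    have "ennreal (pmf p (x, y, z)) = emeasure (poisson_gamma a b l1 l2 l3) {(x, y, z)}"
      by (simp only: emeasure_pmf_single eq[symmetric])
    also have "\<dots> = ennreal (D * negmult_coeff a \<rho>1 \<rho>2 \<rho>3 x y z)"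
      using emeasure_poisson_gamma_singleton[OF pos] by (simp only: defs s_def)
    finally show ?thesis
      using D negmult_coeff_pos[OF pos(1) \<rho>(1-3), of x y z] by (simp add: less_imp_le)
  qed
  \<comment> \<open>The symmetry of the coefficients puts each coordinate first in turn, so that one
    lemma yields all three conditional laws.\<close>
  have p_YXZ: "pmf p (x, y, z) = D * negmult_coeff a \<rho>2 \<rho>1 \<rho>3 y x z" for x y z
    unfolding p by (subst negmult_coeff_swap12) (rule refl)
  have p_ZXY: "pmf p (x, y, z) = D * negmult_coeff a \<rho>3 \<rho>1 \<rho>2 z x y" for x y z
    unfolding p by (subst negmult_coeff_swap23, subst negmult_coeff_swap12) (rule refl)
  have p_pos: "0 < pmf p (x, y, z)" for x y z
    using D negmult_coeff_pos[OF pos(1) \<rho>(1-3), of x y z] by (simp add: p)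
  \<comment> \<open>Within one conditional law both kinds of summands have the same geometric
    distribution, in accordance with \<open>a1 = a2\<close> in the converse direction.\<close>
  let ?W1 = "geometric_pmf (1 - \<rho>1)" and ?W2 = "geometric_pmf (1 - \<rho>2)"
    and ?W3 = "geometric_pmf (1 - \<rho>3)"
  have "\<exists>eps. conditionally_compound p X_of Y_of Z_of ?W1 ?W1 eps"
    by (rule conditionally_compound_negbin[where h = "\<lambda>x y z. (x, y, z)", OF _ _ _ _ pos(1) \<rho>(1,2,3,4) D p])
       (auto simp: coordinate_defs)
  moreover have "\<exists>eps. conditionally_compound p Y_of X_of Z_of ?W2 ?W2 eps"
    by (rule conditionally_compound_negbin[where h = "\<lambda>y x z. (x, y, z)", OF _ _ _ _ pos(1) \<rho>(2,1,3,5) D p_YXZ])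
       (auto simp: coordinate_defs)
  moreover have "\<exists>eps. conditionally_compound p Z_of X_of Y_of ?W3 ?W3 eps"
    by (rule conditionally_compound_negbin[where h = "\<lambda>z x y. (x, y, z)", OF _ _ _ _ pos(1) \<rho>(3,1,2,6) D p_ZXY])
       (auto simp: coordinate_defs)
  ultimately obtain eps1 eps2 eps3 where "conditionally_compound p X_of Y_of Z_of ?W1 ?W1 eps1"
    "conditionally_compound p Y_of X_of Z_of ?W2 ?W2 eps2"
    "conditionally_compound p Z_of X_of Y_of ?W3 ?W3 eps3"
    by blast
  then have "nonconstant ?W1 \<and> nonconstant ?W1 \<and> nonconstant ?W2 \<and> nonconstant ?W2 \<and>
      nonconstant ?W3 \<and> nonconstant ?W3 \<and>
      solves_model p ?W1 ?W1 ?W2 ?W2 ?W3 ?W3 eps1 eps2 eps3"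
    using \<rho> by (simp add: solves_model_def nonconstant_geometric)
  then have "\<exists>W1 W2 W3 W4 W5 W6 eps1 eps2 eps3.
             nonconstant W1 \<and> nonconstant W2 \<and> nonconstant W3 \<and>
             nonconstant W4 \<and> nonconstant W5 \<and> nonconstant W6 \<and>
             solves_model p W1 W2 W3 W4 W5 W6 eps1 eps2 eps3"
    by (intro exI)
  moreover have "count_variables p"
    using p_pos by (simp add: count_variables_iff)
  ultimately show "count_variables p \<and> (\<exists>W1 W2 W3 W4 W5 W6 eps1 eps2 eps3.
             nonconstant W1 \<and> nonconstant W2 \<and> nonconstant W3 \<and>
             nonconstant W4 \<and> nonconstant W5 \<and> nonconstant W6 \<and>
             solves_model p W1 W2 W3 W4 W5 W6 eps1 eps2 eps3)"
    by (intro conjI)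
qed

end
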